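(* Under the Continuum Hypothesis, each zero-dimensional compact Hausdorff space of weight $\le\omega_1$ is homeomorphic to the binary corona of some cellular finitary coarse space $(X,\mathcal E)$ with $|X|=\omega$.
   Context: An entourage on a set $X$ is a subset $E\subseteq X\times X$ containing the diagonal $\Delta_X$; $E^{-1}=\{(y,x):(x,y)\in E\}$, $E\circ F=\{(x,z):\exists y\in X,\ (x,y)\in E,\ (y,z)\in F\}$, $E[x]=\{y\in X:(x,y)\in E\}$. A coarse space $(X,\mathcal E)$ is a set $X$ with a family $\mathcal E$ of entourages (its coarse structure) such that $\bigcup\mathcal E=X\times X$; for all $E,F\in\mathcal E$ there is $G\in\mathcal E$ with $E\circ F^{-1}\subseteq G$; and $\Delta_X\subseteq E\subseteq F\in\mathcal E$ implies $E\in\mathcal E$. A set $B\subseteq X$ is bounded if $B\subseteq E[x]$ for some $E\in\mathcal E$, $x\in X$. The coarse space is finitary if $\sup_{x\in X}|E[x]|$ is finite for every $E\in\mathcal E$, and cellular if each $E\in\mathcal E$ is contained in some $B\in\mathcal E$ that is an equivalence relation. Let $\mathsf 2=\{0,1\}$ with the $\{0,1\}$-valued metric. A function $\varphi:X\to\mathsf 2$ is slowly oscillating if for every $\varepsilon>0$ and $E\in\mathcal E$ there is a bounded set $B\subseteq X$ with $\mathrm{diam}\,\varphi(E[x])<\varepsilon$ for all $x\in X\setminus B$. Let $\mathsf{so}(X,\mathcal E;\mathsf 2)$ be the set of all slowly oscillating functions $X\to\mathsf 2$. The binary compactification $h_{\mathsf 2}(X,\mathcal E)$ is the closure of the image of the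 injective map $X\to\mathsf 2^{\mathsf{so}(X,\mathcal E;\mathsf 2)}$, $x\mapsto(f(x))_f$ (product topology); $X$ is identified with its image. The binary corona of $(X,\mathcal E)$ is $h_{\mathsf 2}(X,\mathcal E)\setminus\bigcup\{\bar B:B\subseteq X\text{ bounded}\}$ (closures in $h_{\mathsf 2}(X,\mathcal E)$); for a finitary coarse space it equals $h_{\mathsf 2}(X,\mathcal E)\setminus X$. *)

theory Defs
  imports "HOL-Analysis.Analysis"
begin

unbundle cardinal_syntax

section \<open>Coarse spaces\<close>

text \<open>Relational composition \<open>O\<close>, converse and image \<open>E `` {x}\<close> of the library are literally
  \<open>E \<circ> F\<close>, \<open>E\<^sup>-\<^sup>1\<close> and the ball \<open>E[x]\<close>.\<close>

definition entourage_on :: "'a set \<Rightarrow> 'a rel \<Rightarrow> bool" where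
  "entourage_on X E \<longleftrightarrow> E \<subseteq> X \<times> X \<and> Id_on X \<subseteq> E"

definition coarse_space :: "'a set \<Rightarrow> 'a rel set \<Rightarrow> bool" where
  "coarse_space X \<E> \<longleftrightarrow>
     (\<forall>E\<in>\<E>. entourage_on X E) \<and>
     \<Union>\<E> = X \<times> X \<and>
     (\<forall>E\<in>\<E>. \<forall>F\<in>\<E>. \<exists>G\<in>\<E>. E O F\<inverse> \<subseteq> G) \<and>
     (\<forall>F\<in>\<E>. \<forall>E. Id_on X \<subseteq> E \<and> E \<subseteq> F \<longrightarrow> E \<in> \<E>)"

definition coarse_bounded :: "'a set \<Rightarrow> 'a rel set \<Rightarrow> 'a set \<Rightarrow> bool" where
  "coarse_bounded X \<E> B \<longleftrightarrow> B \<subseteq> X \<and> (\<exists>E\<in>\<E>. \<exists>x\<in>X. B \<subseteq> E `` {x})"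

definition finitary :: "'a set \<Rightarrow> 'a rel set \<Rightarrow> bool" where
  "finitary X \<E> \<longleftrightarrow> (\<forall>E\<in>\<E>. \<exists>n. \<forall>x\<in>X. finite (E `` {x}) \<and> card (E `` {x}) \<le> n)"

definition cellular :: "'a set \<Rightarrow> 'a rel set \<Rightarrow> bool" where
  "cellular X \<E> \<longleftrightarrow> (\<forall>E\<in>\<E>. \<exists>B\<in>\<E>. E \<subseteq> B \<and> equiv X B)"


section \<open>The binary corona\<close>

text \<open>The space \<open>\<two>\<close> is the metric subspace \<open>{0, 1}\<close> of the real line. Functions on \<open>X\<close> are
  extensional, so that each function on \<open>X\<close> is represented exactly once.\<close>

definition slowly_oscillating2 :: "'a set \<Rightarrow> 'a rel set \<Rightarrow> ('a \<Rightarrow> real) set" where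
  "slowly_oscillating2 X \<E> =
     {\<phi> \<in> X \<rightarrow>\<^sub>E {0, 1}. \<forall>\<epsilon>>0. \<forall>E\<in>\<E>. \<exists>B. coarse_bounded X \<E> B \<and>
        (\<forall>x\<in>X - B. diameter (\<phi> ` (E `` {x})) < \<epsilon>)}"

definition binary_cube :: "'a set \<Rightarrow> 'a rel set \<Rightarrow> (('a \<Rightarrow> real) \<Rightarrow> real) topology" where
  "binary_cube X \<E> = product_topology (\<lambda>_. top_of_set {0, 1}) (slowly_oscillating2 X \<E>)"

definition binary_embedding :: "'a set \<Rightarrow> 'a rel set \<Rightarrow> 'a \<Rightarrow> ('a \<Rightarrow> real) \<Rightarrow> real" where
  "binary_embedding X \<E> x = (\<lambda>f\<in>slowly_oscillating2 X \<E>. f x)"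

definition binary_compactification ::
    "'a set \<Rightarrow> 'a rel set \<Rightarrow> (('a \<Rightarrow> real) \<Rightarrow> real) topology" where
  "binary_compactification X \<E> =
     subtopology (binary_cube X \<E>) (binary_cube X \<E> closure_of (binary_embedding X \<E> ` X))"

definition binary_corona ::
    "'a set \<Rightarrow> 'a rel set \<Rightarrow> (('a \<Rightarrow> real) \<Rightarrow> real) topology" where
  "binary_corona X \<E> =
     subtopology (binary_compactification X \<E>)
       (topspace (binary_compactification X \<E>) -
        \<Union>{binary_compactification X \<E> closure_of (binary_embedding X \<E> ` B) |B.
            coarse_bounded X \<E> B})"


section \<open>Topological and set-theoretic notions\<close>

definition topology_base :: "'a topology \<Rightarrow> 'a set set \<Rightarrow> bool" where
  "topology_base T \<B> \<longleftrightarrow>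
     (\<forall>V\<in>\<B>. openin T V) \<and>
     (\<forall>U x. openin T U \<and> x \<in> U \<longrightarrow> (\<exists>V\<in>\<B>. x \<in> V \<and> V \<subseteq> U))"

text \<open>The library's \<open>T dim_le 0\<close> expresses zero-dimensionality, i.e. the existence of a base of
  clopen sets, but it also holds for the empty space, which has dimension \<open>-1\<close>. The empty space
  is never the binary corona of an infinite finitary coarse space: the points of the space are
  isolated in the infinite compact space \<open>binary_compactification X \<E>\<close>. Nonemptiness is therefore
  stated separately.\<close>

lemma dim_le_0_iff_clopen_base:
  "T dim_le 0 \<longleftrightarrow> (\<exists>\<B>. topology_base T \<B> \<and> (\<forall>V\<in>\<B>. closedin T V))"
  (is "?L \<longleftrightarrow> ?R")
proof
  assume ?L
  then have "topology_base T {V. openin T V \<and> closedin T V}"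
    unfolding topology_base_def dimension_le_0_neighbourhood_base_of_clopen
    by (simp add: open_neighbourhood_base_of) meson
  then show ?R by blast
next
  assume ?R
  then show ?L
    unfolding topology_base_def dimension_le_0_neighbourhood_base_of_clopen
    by (subst open_neighbourhood_base_of) (blast+)
qed

text \<open>The weight of \<open>T\<close>, the least cardinality of a base, is at most the cardinal \<open>\<kappa>\<close>.\<close>

definition weight_le :: "'a topology \<Rightarrow> 'k rel \<Rightarrow> bool" where
  "weight_le T \<kappa> \<longleftrightarrow> (\<exists>\<B>. topology_base T \<B> \<and> |\<B>| \<le>o \<kappa>)"

abbreviation omega1 :: "nat set rel" where
  "omega1 \<equiv> cardSuc natLeq"

definition continuum_hypothesis :: bool where
  "continuum_hypothesis \<longleftrightarrow> |UNIV :: real set| =o omega1"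

end

theory Submission
  imports Defs
begin

text \<open>By Stone duality the space \<open>K\<close> is encoded by its algebra of clopen sets, of size at most
  \<open>\<omega>\<^sub>1\<close>. Suppose that each clopen set \<open>t\<close> of \<open>K\<close> has been given a label, a set \<open>a\<close> of naturals, such
  that \<open>t \<mapsto> a\<close> embeds the algebra into the subsets of the naturals modulo finite sets. Then each
  point of \<open>K\<close> becomes a limit of naturals, and this limit identifies \<open>K\<close> with a binary corona as soon
  as the slowly oscillating sets are exactly the Boolean combinations of labels, up to finite sets.

  The labels and a coarse structure with this property are constructed simultaneously. By the
  continuum hypothesis the clopen sets of \<open>K\<close> and all sets \<open>b\<close> of naturals are indexed by a
  well-order whose initial segments are countable, so a recursion (\<open>countable_stage_recursion\<close>) has
  to deal only with countably many labels and countably many finitary equivalence relations at a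
  time. A stage does two things. It labels one more clopen set by a set that the given relations
  respect up to finitely many pairs (\<open>extend_approximation\<close>). And if a set \<open>b\<close> is not a combination of
  the labels, it adds a finitary equivalence relation that respects the labels and splits \<open>b\<close>
  infinitely often (\<open>destroy_undetermined_set\<close>); since later labels must be respected by that
  relation too, \<open>b\<close> is excluded for ever. Thus the construction never has to know in advance which
  sets will be combinations of labels. Both steps become easy after cutting the naturals
  into finite levels that are adapted to the given countable family of relations
  (\<open>exists_levels\<close>). Unions of chains cause no difficulty, since all conditions concern finitely
  many labels and relations (\<open>scheme_Union_chain\<close>).

  In the resulting coarse space the bounded sets are the finite ones, and the slowly oscillating
  functions are the indicators of combinations of labels (\<open>SO_iff\<close>). The limit of these functions
  at \<open>z \<in> K\<close> is a point of the corona; that it depends continuously and injectively on \<open>z\<close>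
  is read off from the clopen labelled sets, and surjectivity is compactness of \<open>K\<close>
  (\<open>exists_point_of_corona_point\<close>).\<close>


section \<open>Recursion along a well-order with countable initial segments\<close>

text \<open>Each stage is the union of the earlier ones, extended so as to meet one more requirement.
  A stage has only countably many predecessors, so it stays countable and \<open>step\<close> applies to it;
  only the final union may be uncountable. Requirements survive because \<open>D\<close> is monotone.\<close>

lemma countable_stage_recursion:
  fixes r :: "'i rel" and P0 :: "'p set" and D :: "'i \<Rightarrow> 'p set \<Rightarrow> bool"
  assumes wf: "wf r" and trans: "trans r" and total: "total r"
    and seg: "\<And>i. countable {j. (j, i) \<in> r}"
    and base: "good P0" "countable P0"
    and step: "\<And>i P. good P \<Longrightarrow> countable P \<Longrightarrow> P0 \<subseteq> P \<Longrightarrow> \<exists>P'. P \<subseteq> P' \<and> good P' \<and> countable P' \<and> D i P'"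
    and union: "\<And>\<C>. \<C> \<noteq> {} \<Longrightarrow> (\<And>P P'. P \<in> \<C> \<Longrightarrow> P' \<in> \<C> \<Longrightarrow> P \<subseteq> P' \<or> P' \<subseteq> P) \<Longrightarrow>
                  (\<And>P. P \<in> \<C> \<Longrightarrow> good P) \<Longrightarrow> good (\<Union>\<C>)"
    and mono: "\<And>i P P'. D i P \<Longrightarrow> P \<subseteq> P' \<Longrightarrow> D i P'"
  shows "\<exists>Q. P0 \<subseteq> Q \<and> good Q \<and> (\<forall>i. D i Q)"
proof -
  define extend where "extend i P = (SOME P'. P \<subseteq> P' \<and> good P' \<and> countable P' \<and> D i P')" for i P
  have extend: "P \<subseteq> extend i P \<and> good (extend i P) \<and> countable (extend i P) \<and> D i (extend i P)"
    if "good P" "countable P" "P0 \<subseteq> P" for i P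
    unfolding extend_def by (rule someI_ex) (use step[OF that] in blast)
  define F where "F f i = extend i (P0 \<union> (\<Union>j\<in>{j. (j, i) \<in> r}. f j))" for f i
  define g where "g = wfrec r F"
  have "adm_wf r F"
    unfolding adm_wf_def F_def by (metis (no_types, lifting) SUP_cong mem_Collect_eq)
  then have g: "g i = extend i (P0 \<union> (\<Union>j\<in>{j. (j, i) \<in> r}. g j))" for i
    unfolding g_def using wfrec_fixpoint[OF wf] by (metis F_def)
  \<comment> \<open>The first conjunct makes the earlier stages a chain, which is what \<open>union\<close> needs for \<open>good\<close>.\<close>
  have main: "P0 \<union> (\<Union>j\<in>{j. (j, i) \<in> r}. g j) \<subseteq> g i \<and> good (g i) \<and> countable (g i) \<and> D i (g i)" for i
    using wf
  proof (induction i rule: wf_induct_rule)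
    case (less i)
    let ?\<C> = "insert P0 (g ` {j. (j, i) \<in> r})"
    have eq: "P0 \<union> (\<Union>j\<in>{j. (j, i) \<in> r}. g j) = \<Union>?\<C>"
      by simp
    have lin: "g j \<subseteq> g k \<or> g k \<subseteq> g j" if "(j, i) \<in> r" "(k, i) \<in> r" for j k
    proof -
      have "j = k \<or> (j, k) \<in> r \<or> (k, j) \<in> r"
        using total unfolding total_on_def by blast
      then show ?thesis
        using less[OF that(1)] less[OF that(2)] by blast
    qed
    have "good (\<Union>?\<C>)"
    proof (rule union)
      show "P \<subseteq> P' \<or> P' \<subseteq> P" if "P \<in> ?\<C>" "P' \<in> ?\<C>" for P P'
        using that
      proof (elim insertE imageE)
        fix j k assume "P = g j" "P' = g k" "j \<in> {j. (j, i) \<in> r}" "k \<in> {j. (j, i) \<in> r}"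
        then show ?thesis
          using lin by simp
      qed (use less in blast)+
    qed (use base less in auto)
    moreover have "countable (\<Union>?\<C>)"
      using seg base less by auto
    ultimately show ?case
      unfolding g[of i] eq by (intro extend) auto
  qed
  define Q where "Q = \<Union>(insert P0 (range g))"
  have "good Q"
    unfolding Q_def
  proof (rule union)
    have "g j \<subseteq> g k \<or> g k \<subseteq> g j" for j k
    proof -
      have "j = k \<or> (j, k) \<in> r \<or> (k, j) \<in> r"
        using total unfolding total_on_def by blast
      then show ?thesis
        using main[of j] main[of k] by blast
    qed
    then show "P \<subseteq> P' \<or> P' \<subseteq> P" if "P \<in> insert P0 (range g)" "P' \<in> insert P0 (range g)" for P P'
      using that main by blast
  qed (use base main in auto)
  moreover have "D i Q" for i
  proof (rule mono)
    show "D i (g i)"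
      using main by blast
    show "g i \<subseteq> Q"
      unfolding Q_def by auto
  qed
  moreover have "P0 \<subseteq> Q"
    unfolding Q_def by auto
  ultimately show ?thesis
    by auto
qed


section \<open>Finitary equivalence relations\<close>

definition bounded_cells :: "nat rel \<Rightarrow> bool" where
  "bounded_cells E \<longleftrightarrow> equiv UNIV E \<and> (\<exists>N. \<forall>x. finite (E `` {x}) \<and> card (E `` {x}) \<le> N)"

lemma bounded_cells_equiv: "bounded_cells E \<Longrightarrow> equiv UNIV E"
  and bounded_cells_finite: "bounded_cells E \<Longrightarrow> finite (E `` {x})"
  unfolding bounded_cells_def by blast+

lemma bounded_cells_finite_Image:
  assumes "bounded_cells E" "finite F"
  shows "finite (E `` F)"
proof -
  have "E `` F = (\<Union>x\<in>F. E `` {x})"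
    by auto
  then show ?thesis
    using assms bounded_cells_finite by simp
qed

text \<open>The cells that meet no member of \<open>\<D>\<close> survive, and the members of \<open>\<D>\<close> become cells, because
  they are pairwise disjoint unions of cells. So the size bound is the larger of the two bounds.\<close>

lemma merge_cells:
  assumes E: "bounded_cells E"
    and sat: "\<And>D. D \<in> \<D> \<Longrightarrow> E `` D \<subseteq> D"
    and disj: "\<And>D D'. D \<in> \<D> \<Longrightarrow> D' \<in> \<D> \<Longrightarrow> D \<inter> D' \<noteq> {} \<Longrightarrow> D = D'"
    and bdd: "\<And>D. D \<in> \<D> \<Longrightarrow> finite D \<and> card D \<le> M"
  shows "bounded_cells (E \<union> (\<Union>D\<in>\<D>. D \<times> D))"
proof -
  let ?G = "E \<union> (\<Union>D\<in>\<D>. D \<times> D)"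
  have eq: "equiv UNIV E"
    using E by (rule bounded_cells_equiv)
  have refl: "refl ?G" and sym: "sym ?G"
    using eq unfolding equiv_def refl_on_def sym_def by auto
  have cl: "y \<in> D" if "(x, y) \<in> E" "D \<in> \<D>" "x \<in> D" for x y D
    using sat that by blast
  have cell: "?G `` {x} = D" if "D \<in> \<D>" "x \<in> D" for x D
    using that cl disj by blast
  have cell': "?G `` {x} = E `` {x}" if "x \<notin> \<Union>\<D>" for x
    using that by auto
  have "trans ?G"
  proof (rule transI)
    fix x y z
    assume xy: "(x, y) \<in> ?G" and yz: "(y, z) \<in> ?G"
    show "(x, z) \<in> ?G"
    proof (cases "x \<in> \<Union>\<D>")
      case True
      then obtain D where D: "D \<in> \<D>" "x \<in> D"
        by blast
      then have "y \<in> D"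
        using cell[OF D] xy by blast
      then have "z \<in> D"
        using cell[OF D(1)] yz by blast
      then show ?thesis
        using D by blast
    next
      case False
      then have "(x, y) \<in> E"
        using xy by blast
      moreover have "y \<notin> \<Union>\<D>"
        using False cl[of y x] \<open>(x, y) \<in> E\<close> eq unfolding equiv_def sym_def by blast
      then have "(y, z) \<in> E"
        using yz by blast
      ultimately show ?thesis
        using eq unfolding equiv_def trans_def by blast
    qed
  qed
  then have "equiv UNIV ?G"
    using refl sym by (simp add: equiv_def)
  moreover obtain N where N: "\<And>x. finite (E `` {x}) \<and> card (E `` {x}) \<le> N"
    using E unfolding bounded_cells_def by blast
  have "finite (?G `` {x}) \<and> card (?G `` {x}) \<le> max M N" for x
  proof (cases "x \<in> \<Union>\<D>")
    case True
    then obtain D where "D \<in> \<D>" "x \<in> D"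
      by blast
    then show ?thesis
      using cell[of D x] bdd[of D] by (simp add: max.coboundedI1)
  next
    case False
    then show ?thesis
      using cell'[of x] N[of x] by (simp add: max.coboundedI2)
  qed
  ultimately show ?thesis
    unfolding bounded_cells_def by blast
qed

lemma cofinal_sequence_of_relations:
  fixes R :: "'b rel set"
  assumes "countable R" "R \<noteq> {}"
    and dir: "\<And>E F. E \<in> R \<Longrightarrow> F \<in> R \<Longrightarrow> \<exists>G\<in>R. E \<union> F \<subseteq> G"
  shows "\<exists>E. (\<forall>k. E k \<in> R) \<and> (\<forall>k. E k \<subseteq> E (Suc k)) \<and> (\<forall>F\<in>R. \<exists>k. F \<subseteq> E k)"
proof -
  let ?r = "from_nat_into R"
  have r: "?r n \<in> R" for n
    using assms(2) by (rule from_nat_into)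
  have "\<exists>E. \<forall>k. E k \<in> R \<and> (E k \<subseteq> E (Suc k) \<and> ?r k \<subseteq> E (Suc k))"
  proof (rule dependent_nat_choice)
    show "\<exists>E. E \<in> R"
      using assms(2) by blast
    show "\<exists>F. F \<in> R \<and> (E \<subseteq> F \<and> ?r k \<subseteq> F)" if "E \<in> R" for E k
      using dir[OF that r[of k]] by auto
  qed
  then obtain E where E: "\<And>k. E k \<in> R" "\<And>k. E k \<subseteq> E (Suc k)" "\<And>k. ?r k \<subseteq> E (Suc k)"
    by blast
  have "\<exists>k. F \<subseteq> E k" if "F \<in> R" for F
    using that E(3) from_nat_into_surj[OF assms(1)] by metis
  then show ?thesis
    using E by blast
qed

text \<open>The points of level \<open>k\<close> are those of \<open>V k - V (Suc k)\<close>. As \<open>V k\<close> is a union of cells of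
  \<open>E k\<close> and \<open>V (Suc k)\<close> is even a union of cells of the coarser \<open>E (Suc k)\<close>, each level is a finite
  union of cells of \<open>E k\<close>. Hence a construction may proceed level by level: if it respects the cells
  of \<open>E k\<close> at level \<open>k\<close>, then it respects every fixed \<open>E j\<close> outside the finite set \<open>- V j\<close>.
  The points of \<open>B k\<close>, exceptional for step \<open>k\<close>, lie before level \<open>k\<close>, and \<open>W k\<close> is a
  witness for \<open>P k\<close> whose cells lie in level \<open>k\<close>.\<close>

lemma exists_levels:
  fixes E :: "nat \<Rightarrow> nat rel"
  assumes E: "\<And>k. bounded_cells (E k)" and E_mono: "\<And>k. E k \<subseteq> E (Suc k)"
    and B: "\<And>k. finite (B k)"
    and W: "\<And>k F. finite F \<Longrightarrow> \<exists>W. finite W \<and> W \<inter> F = {} \<and> P k W"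
  obtains V W where "\<And>k. V (Suc k) \<subseteq> V k" "\<And>k. finite (- V k)" "\<And>k. E k `` V k \<subseteq> V k"
    "\<And>k. V k \<inter> B k = {}" "\<And>k. P k (W k)" "\<And>k. E k `` W k \<subseteq> V k - V (Suc k)"
    "\<And>n. \<exists>k. n \<notin> V k"
proof -
  let ?S = "\<lambda>k x. finite (- fst x) \<and> E k `` fst x \<subseteq> fst x \<and> fst x \<inter> B k = {} \<and>
      P k (snd x) \<and> finite (snd x) \<and> snd x \<subseteq> fst x"
  let ?next = "\<lambda>k x y. fst y \<subseteq> fst x \<and> fst y \<inter> E k `` snd x = {} \<and> k \<notin> fst y"
  have refl: "F \<subseteq> E k `` F" for F k
    using bounded_cells_equiv[OF E[of k]] unfolding equiv_def refl_on_def by blast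
  have compl: "E k `` (- (E k `` F)) \<subseteq> - (E k `` F)" for F k
  proof -
    have "sym (E k)" "trans (E k)"
      using bounded_cells_equiv[OF E[of k]] by (simp_all add: equiv_def)
    then show ?thesis
      unfolding sym_def trans_def by blast
  qed
  \<comment> \<open>The set \<open>V\<close> is the complement of a finite union of cells, hence itself a union of cells.\<close>
  have cut: "\<exists>V W. ?S k (V, W) \<and> V \<inter> F = {}" if F: "finite F" for k F
  proof -
    define V where "V = - (E k `` (F \<union> B k))"
    have fin: "finite (- V)"
      unfolding V_def using F B bounded_cells_finite_Image[OF E] by simp
    obtain W' where "finite W'" "W' \<inter> (- V) = {}" "P k W'"
      using W[OF fin] by blast
    moreover have "E k `` V \<subseteq> V"
      unfolding V_def by (rule compl)
    moreover have "V \<inter> B k = {}" "V \<inter> F = {}"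
      using refl[of "F \<union> B k" k] unfolding V_def by blast+
    ultimately have "?S k (V, W')" "V \<inter> F = {}"
      using fin by auto
    then show ?thesis
      by blast
  qed
  have "\<exists>f. \<forall>k. ?S k (f k) \<and> ?next k (f k) (f (Suc k))"
  proof (rule dependent_nat_choice)
    show "\<exists>x. ?S 0 x"
      using cut[of "{}" 0] by blast
    show "\<exists>y. ?S (Suc k) y \<and> ?next k x y" if x: "?S k x" for x k
    proof -
      obtain V W where VW: "x = (V, W)"
        by force
      have "finite (- V \<union> E k `` W \<union> {k})"
        using x bounded_cells_finite_Image[OF E] VW by simp
      from cut[OF this, of "Suc k"] obtain V' W' where "?S (Suc k) (V', W')"
        "V' \<inter> (- V \<union> E k `` W \<union> {k}) = {}"
        by blast
      then have "?S (Suc k) (V', W') \<and> ?next k x (V', W')"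
        using VW by auto
      then show ?thesis
        by (rule exI)
    qed
  qed
  then obtain f where "\<forall>k. ?S k (f k) \<and> ?next k (f k) (f (Suc k))"
    by (rule exE)
  then have f: "?S k (f k)" "?next k (f k) (f (Suc k))" for k
    by simp_all
  have W_lev: "E k `` snd (f k) \<subseteq> fst (f k) - fst (f (Suc k))" for k
  proof -
    have "E k `` snd (f k) \<subseteq> E k `` fst (f k)"
      using f(1)[of k] by blast
    then show ?thesis
      using f(1)[of k] f(2)[of k] by blast
  qed
  have empty: "\<exists>k. n \<notin> fst (f k)" for n
    using f(2)[of n] by blast
  show ?thesis
    by (rule that[of "\<lambda>k. fst (f k)" "\<lambda>k. snd (f k)"]) (use f W_lev empty in blast)+
qed


section \<open>Approximations of a Boolean space\<close>

text \<open>A pair \<open>(t, a)\<close> says that the set \<open>a\<close> of natural numbers labels the subset \<open>t\<close> of a space.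
  If the naturals are thought of as points next to the space, then \<open>fits T n z\<close> means
  that the labels in \<open>T\<close> do not tell \<open>n\<close> from \<open>z\<close>.\<close>

definition fits :: "('a set \<times> nat set) set \<Rightarrow> nat \<Rightarrow> 'a \<Rightarrow> bool" where
  "fits T n z \<longleftrightarrow> (\<forall>t a. (t, a) \<in> T \<longrightarrow> (n \<in> a \<longleftrightarrow> z \<in> t))"

definition same_labels :: "('a set \<times> nat set) set \<Rightarrow> nat \<Rightarrow> nat \<Rightarrow> bool" where
  "same_labels T n m \<longleftrightarrow> (\<forall>t a. (t, a) \<in> T \<longrightarrow> (n \<in> a \<longleftrightarrow> m \<in> a))"

text \<open>For finite \<open>T\<close> this means that \<open>b\<close> differs by a finite set from a Boolean combination of the
  labels in \<open>T\<close>.\<close>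

definition determined_by :: "('a set \<times> nat set) set \<Rightarrow> nat set \<Rightarrow> bool" where
  "determined_by T b \<longleftrightarrow>
     (\<exists>F. finite F \<and> (\<forall>n\<in>-F. \<forall>m\<in>-F. same_labels T n m \<longrightarrow> (n \<in> b \<longleftrightarrow> m \<in> b)))"

text \<open>Modulo finite sets, a Boolean combination of labels is empty exactly if the same combination
  of the labelled sets is empty. So sending \<open>t\<close> to \<open>a\<close> embeds the algebra generated by the labelled
  sets into the subsets of the naturals modulo finite sets; in particular two labels of the same set
  differ by a finite set. The condition speaks of finite \<open>T\<close> only, so that it passes to
  unions of chains.\<close>

definition approximation :: "'a set \<Rightarrow> ('a set \<times> nat set) set \<Rightarrow> bool" where
  "approximation X H \<longleftrightarrow>
     (\<forall>T. finite T \<and> T \<subseteq> H \<longrightarrow>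
        (\<forall>z\<in>X. infinite {n. fits T n z}) \<and> finite {n. \<nexists>z. z \<in> X \<and> fits T n z})"

text \<open>If \<open>E\<close> is an equivalence relation with finite cells, then this says that all but finitely many
  cells lie on one side of each label.\<close>

definition compatible :: "('a set \<times> nat set) set \<Rightarrow> nat rel \<Rightarrow> bool" where
  "compatible H E \<longleftrightarrow> (\<forall>t a. (t, a) \<in> H \<longrightarrow> finite (E \<inter> a \<times> - a))"

lemma approximation_infinite: "infinite {n. fits T n z}"
  and approximation_finite: "finite {n. \<nexists>z. z \<in> X \<and> fits T n z}"
  if "approximation X H" "finite T" "T \<subseteq> H" "z \<in> X"
  using that unfolding approximation_def by auto

lemma fits_mono: "fits T n z \<Longrightarrow> S \<subseteq> T \<Longrightarrow> fits S n z"
  unfolding fits_def by blast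

lemma fits_Un: "fits (S \<union> T) n z \<longleftrightarrow> fits S n z \<and> fits T n z"
  unfolding fits_def by auto

lemma fits_same_labels: "fits T n z \<Longrightarrow> fits T m z \<Longrightarrow> same_labels T n m"
  unfolding fits_def same_labels_def by blast

lemma same_labels_sym: "same_labels T n m \<Longrightarrow> same_labels T m n"
  unfolding same_labels_def by blast

lemma not_determined_by:
  assumes "\<not> determined_by T b" "finite F"
  shows "\<exists>n m. n \<notin> F \<and> m \<notin> F \<and> same_labels T n m \<and> n \<in> b \<and> m \<notin> b"
proof -
  have "\<not> (\<forall>n\<in>-F. \<forall>m\<in>-F. same_labels T n m \<longrightarrow> (n \<in> b \<longleftrightarrow> m \<in> b))"
    using assms unfolding determined_by_def by simp
  then show ?thesis
    using same_labels_sym by (metis ComplD)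
qed

text \<open>An increasing sequence of finite sets is convenient because, at level \<open>k\<close>, a construction
  can take care of the labels in \<open>T k\<close>; each finite set of labels is then handled at almost all levels.\<close>

lemma finite_exhaustion:
  assumes "countable H"
  obtains T :: "nat \<Rightarrow> 'b set" where "\<And>k. finite (T k)" "\<And>k. T k \<subseteq> H" "\<And>j k. j \<le> k \<Longrightarrow> T j \<subseteq> T k"
    "\<And>F. finite F \<Longrightarrow> F \<subseteq> H \<Longrightarrow> \<exists>k. F \<subseteq> T k"
proof -
  define T where "T k = {x \<in> H. to_nat_on H x < k}" for k
  show thesis
  proof (rule that[of T])
    show "finite (T k)" for k
    proof (rule finite_imageD)
      show "finite (to_nat_on H ` T k)"
        by (rule finite_subset[of _ "{..<k}"]) (auto simp: T_def)
      show "inj_on (to_nat_on H) (T k)"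
        using inj_on_to_nat_on[OF assms] by (rule inj_on_subset) (auto simp: T_def)
    qed
    show "T k \<subseteq> H" for k
      by (auto simp: T_def)
    show "T j \<subseteq> T k" if "j \<le> k" for j k
      using that by (auto simp: T_def)
    show "\<exists>k. F \<subseteq> T k" if F: "finite F" "F \<subseteq> H" for F
    proof (intro exI subsetI)
      fix x assume "x \<in> F"
      then have "to_nat_on H x \<le> Max (to_nat_on H ` F)"
        using F by simp
      then show "x \<in> T (Suc (Max (to_nat_on H ` F)))"
        using F \<open>x \<in> F\<close> by (auto simp: T_def less_Suc_eq_le)
    qed
  qed
qed

text \<open>There are only countably many pairs of a finite \<open>S \<subseteq> C\<close> and a subset of \<open>S\<close>, and one point for
  each pair is enough.\<close>

lemma countable_trace_representatives:
  assumes "countable C"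
  obtains Z where "countable Z" "Z \<subseteq> X"
    "\<And>S z. finite S \<Longrightarrow> S \<subseteq> C \<Longrightarrow> z \<in> X \<Longrightarrow> \<exists>z'\<in>Z. \<forall>t\<in>S. z' \<in> t \<longleftrightarrow> z \<in> t"
proof -
  let ?Fin = "{S. S \<subseteq> C \<and> finite S}"
  define pick where "pick = (\<lambda>(S, S'). SOME z. z \<in> X \<and> {t\<in>S. z \<in> t} = S')"
  let ?Z = "pick ` (?Fin \<times> ?Fin) \<inter> X"
  have "countable ?Fin"
    using countable_Collect_finite_subset[OF assms] by (simp add: conj_commute)
  then have "countable ?Z"
    by simp
  moreover have "\<exists>z'\<in>?Z. \<forall>t\<in>S. z' \<in> t \<longleftrightarrow> z \<in> t" if S: "finite S" "S \<subseteq> C" "z \<in> X" for S z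
  proof -
    let ?z = "pick (S, {t\<in>S. z \<in> t})"
    have "?z \<in> X \<and> {t\<in>S. ?z \<in> t} = {t\<in>S. z \<in> t}"
      unfolding pick_def prod.case by (rule someI_ex) (use S in blast)
    moreover have "(S, {t\<in>S. z \<in> t}) \<in> ?Fin \<times> ?Fin"
      using S by auto
    ultimately have "?z \<in> ?Z" "\<forall>t\<in>S. ?z \<in> t \<longleftrightarrow> z \<in> t"
      by auto
    then show ?thesis
      by (rule bexI[rotated])
  qed
  ultimately show thesis
    using that[of ?Z] by blast
qed

definition split_points :: "('a set \<times> nat set) set \<Rightarrow> nat rel \<Rightarrow> nat set" where
  "split_points T E = (\<Union>(t, a)\<in>T. fst ` (E \<inter> a \<times> - a) \<union> snd ` (E \<inter> a \<times> - a))"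

lemma finite_split_points: "finite T \<Longrightarrow> T \<subseteq> H \<Longrightarrow> compatible H E \<Longrightarrow> finite (split_points T E)"
  unfolding split_points_def compatible_def by auto

lemma same_labels_outside_split_points:
  assumes "sym E" "(n, m) \<in> E" "n \<notin> split_points T E"
  shows "same_labels T n m"
  unfolding same_labels_def
proof clarify
  fix t a assume ta: "(t, a) \<in> T"
  have "n \<notin> fst ` (E \<inter> a \<times> - a)" "n \<notin> snd ` (E \<inter> a \<times> - a)"
    using assms(3) ta unfolding split_points_def by blast+
  moreover have "(m, n) \<in> E"
    using assms by (auto dest: symD)
  ultimately show "n \<in> a \<longleftrightarrow> m \<in> a"
    using assms(2) by (force simp: image_iff)
qed

text \<open>A label for a further set \<open>c\<close>. Each cell of \<open>E k\<close> at level \<open>k\<close> is assigned a single point of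
  \<open>X\<close> that the labels in \<open>T k\<close> do not tell from its members, and \<open>a\<close> consists of the naturals whose
  point lies in \<open>c\<close>. Being constant on cells makes \<open>a\<close> compatible with all \<open>E k\<close>, whatever \<open>c\<close> is.
  One cell per level is assigned a point prescribed in advance, and the prescribed points run
  infinitely often through representatives of all traces; this makes every combination that is
  nonempty in \<open>X\<close> infinite on the naturals.\<close>

lemma extend_approximation:
  fixes E :: "nat \<Rightarrow> nat rel" and X :: "'a set"
  assumes H: "approximation X H" "countable H"
    and E: "\<And>k. bounded_cells (E k)" and E_mono: "\<And>k. E k \<subseteq> E (Suc k)"
    and comp: "\<And>k. compatible H (E k)"
    and X: "X \<noteq> {}"
  shows "\<exists>a. approximation X (insert (c, a) H) \<and> (\<forall>k. compatible (insert (c, a) H) (E k))"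
proof -
  obtain T :: "nat \<Rightarrow> ('a set \<times> nat set) set" where T: "\<And>k. finite (T k)" "\<And>k. T k \<subseteq> H" "\<And>j k. j \<le> k \<Longrightarrow> T j \<subseteq> T k"
    "\<And>F. finite F \<Longrightarrow> F \<subseteq> H \<Longrightarrow> \<exists>k. F \<subseteq> T k"
    by (rule finite_exhaustion[OF H(2)], rule that)
  have traces: "countable (insert c (fst ` H))"
    using H(2) by simp
  obtain Z where Z: "countable Z" "Z \<subseteq> X"
    "\<And>S z. finite S \<Longrightarrow> S \<subseteq> insert c (fst ` H) \<Longrightarrow> z \<in> X \<Longrightarrow> \<exists>z'\<in>Z. \<forall>t\<in>S. z' \<in> t \<longleftrightarrow> z \<in> t"
    by (rule countable_trace_representatives[where X = X, OF traces], rule that)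
  have Z_ne: "Z \<noteq> {}"
    using Z(3)[of "{}"] X by blast
  define z where "z k = from_nat_into Z (fst (prod_decode k))" for k
  have z: "z k \<in> X" for k
    using from_nat_into[OF Z_ne] Z(2) unfolding z_def by blast
  \<comment> \<open>The second component of \<open>prod_decode k\<close> is free, so each point recurs infinitely often.\<close>
  have z_inf: "infinite {k. z k = z'}" if z': "z' \<in> Z" for z'
  proof -
    obtain i where i: "from_nat_into Z i = z'"
      using from_nat_into_surj[OF Z(1) z'] by blast
    have "range (\<lambda>j. prod_encode (i, j)) \<subseteq> {k. z k = z'}"
      by (auto simp: z_def i)
    moreover have "infinite (range (\<lambda>j. prod_encode (i, j)))"
      by (rule range_inj_infinite) (auto simp: inj_def)
    ultimately show ?thesis
      by (rule infinite_super)
  qed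
  \<comment> \<open>Outside \<open>B k\<close>, the cells of \<open>E k\<close> are not split by labels in \<open>T k\<close> and fit some point of \<open>X\<close>.\<close>
  define B where "B k = split_points (T k) (E k) \<union> {n. \<nexists>z. z \<in> X \<and> fits (T k) n z}" for k
  have B_fin: "finite (B k)" for k
    using finite_split_points[OF T(1,2) comp] approximation_finite[OF H(1) T(1,2) z]
    unfolding B_def by simp
  have q_ex: "\<exists>W. finite W \<and> W \<inter> F = {} \<and> (\<exists>q. W = {q} \<and> fits (T k) q (z k))" if "finite F" for k F
  proof -
    have "infinite {n. fits (T k) n (z k)}"
      using approximation_infinite[OF H(1) T(1,2) z] .
    then have "infinite ({n. fits (T k) n (z k)} - F)"
      using that by simp
    then have "{n. fits (T k) n (z k)} - F \<noteq> {}"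
      by (rule infinite_imp_nonempty)
    then obtain q where "q \<in> {n. fits (T k) n (z k)} - F"
      by blast
    then show ?thesis
      by (intro exI[of _ "{q}"]) auto
  qed
  obtain V W where V_dec: "\<And>k. V (Suc k) \<subseteq> V k" and V_fin: "\<And>k. finite (- V k)"
    and V_cl: "\<And>k. E k `` V k \<subseteq> V k" and VB: "\<And>k. V k \<inter> B k = {}"
    and W: "\<And>k. \<exists>q. W k = {q} \<and> fits (T k) q (z k)" and W_lev: "\<And>k. E k `` W k \<subseteq> V k - V (Suc k)"
    and V_empty: "\<And>n. \<exists>k. n \<notin> V k"
    by (rule exists_levels[where E = E and B = B and
          P = "\<lambda>k W. \<exists>q. W = {q} \<and> fits (T k) q (z k)", OF E E_mono B_fin q_ex], assumption, rule that)
  obtain q where q: "\<And>k. W k = {q k}" "\<And>k. fits (T k) (q k) (z k)"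
    using W by metis
  have E_equiv: "equiv UNIV (E k)" for k
    using E by (rule bounded_cells_equiv)
  have E_sym: "sym (E k)" for k
    using E_equiv by (simp add: equiv_def)
  have E_refl: "(x, x) \<in> E k" for x k
    using E_equiv[of k] by (simp add: equiv_def refl_on_def)
  have E_mono': "E j \<subseteq> E k" if "j \<le> k" for j k
    using lift_Suc_mono_le[of E, OF E_mono that] .
  have V_anti: "V k \<subseteq> V j" if "j \<le> k" for j k
    using lift_Suc_antimono_le[of V, OF V_dec that] .
  define lev where "lev k = V k - V (Suc k)" for k
  have lev_unique: "j = k" if "n \<in> lev j" "n \<in> lev k" for j k n
    using that V_anti[of "Suc j" k] V_anti[of "Suc k" j] unfolding lev_def
    by (metis DiffD1 DiffD2 not_less_eq_eq le_antisym subsetD linorder_linear)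
  have lev_ex: "\<exists>j\<ge>k. n \<in> lev j" if "n \<in> V k" for n k
  proof -
    obtain i where i: "n \<notin> V i"
      using V_empty by blast
    have "\<exists>j\<ge>k. n \<in> V j \<and> n \<notin> V (Suc j)"
    proof (rule ccontr)
      assume no: "\<not> ?thesis"
      have "n \<in> V (k + d)" for d
        by (induction d) (use that no in auto)
      then have "n \<in> V (k + i)" .
      then show False
        using i V_anti[of i "k + i"] by auto
    qed
    then show ?thesis
      unfolding lev_def by blast
  qed
  have q_lev: "q k \<in> lev k" for k
    using W_lev[of k] q(1)[of k] E_refl unfolding lev_def by blast
  \<comment> \<open>Defined on cells rather than on their members, so that it is constant on cells by construction.\<close>
  define g where "g k C = (if C = E k `` {q k} then z k
      else SOME z. z \<in> X \<and> (\<forall>m\<in>C. fits (T k) m z))" for k C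
  define val where "val k n = g k (E k `` {n})" for k n
  have lev_labels: "same_labels (T k) n m" if "n \<in> V k" "(n, m) \<in> E k" for n m k
    using same_labels_outside_split_points[OF E_sym that(2)] VB[of k] that(1) unfolding B_def by blast
  have val: "val k n \<in> X \<and> fits (T k) n (val k n)" if n: "n \<in> V k" for n k
  proof (cases "E k `` {n} = E k `` {q k}")
    case True
    then have "same_labels (T k) n (q k)"
      using lev_labels[OF n, of "q k"] E_refl by blast
    then show ?thesis
      using q(2)[of k] True z unfolding val_def g_def fits_def same_labels_def by fastforce
  next
    case False
    obtain z' where "z' \<in> X" "fits (T k) n z'"
      using VB[of k] n unfolding B_def by blast
    then have "z' \<in> X \<and> (\<forall>m\<in>E k `` {n}. fits (T k) m z')"
      using lev_labels[OF n] unfolding fits_def same_labels_def by fastforce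
    then have "val k n \<in> X \<and> (\<forall>m\<in>E k `` {n}. fits (T k) m (val k n))"
      unfolding val_def g_def using False by simp (rule someI)
    then show ?thesis
      using E_refl by blast
  qed
  define a where "a = {n. \<exists>k. n \<in> lev k \<and> val k n \<in> c}"
  have a_iff: "n \<in> a \<longleftrightarrow> val k n \<in> c" if "n \<in> lev k" for n k
    using that lev_unique unfolding a_def by blast
  have fits: "fits (insert (c, a) (T k)) n (val k n)" if "n \<in> lev k" for n k
    using val[of n k] a_iff[OF that] that unfolding fits_def lev_def by auto
  have "approximation X (insert (c, a) H)"
    unfolding approximation_def
  proof (intro allI impI conjI ballI; elim conjE)
    fix S assume S: "finite S" "S \<subseteq> insert (c, a) H"
    then obtain k where k: "S - {(c, a)} \<subseteq> T k"
      using T(4)[of "S - {(c, a)}"] by blast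
    have S_sub: "S \<subseteq> insert (c, a) (T j)" if "j \<ge> k" for j
      using k T(3)[OF that] by blast
    have "{n. \<nexists>z. z \<in> X \<and> fits S n z} \<subseteq> - V k"
    proof (clarify)
      fix n assume no: "\<nexists>z. z \<in> X \<and> fits S n z" and "n \<in> V k"
      then obtain j where j: "j \<ge> k" "n \<in> lev j"
        using lev_ex by blast
      then have "fits S n (val j n)" "val j n \<in> X"
        using fits_mono[OF fits S_sub] val[of n j] unfolding lev_def by blast+
      then show False
        using no by blast
    qed
    then show "finite {n. \<nexists>z. z \<in> X \<and> fits S n z}"
      using V_fin finite_subset by blast
    fix x assume x: "x \<in> X"
    obtain z' where z': "z' \<in> Z" "\<And>t. t \<in> fst ` S \<Longrightarrow> z' \<in> t \<longleftrightarrow> x \<in> t"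
      using Z(3)[of "fst ` S" x] S x by fastforce
    have "infinite ({j. z j = z'} - {..<k})"
      using z_inf[OF z'(1)] by simp
    moreover have "inj_on q ({j. z j = z'} - {..<k})"
      using q_lev lev_unique by (metis inj_onI)
    ultimately have "infinite (q ` ({j. z j = z'} - {..<k}))"
      using finite_imageD by blast
    moreover have "q ` ({j. z j = z'} - {..<k}) \<subseteq> {n. fits S n x}"
    proof
      fix n assume "n \<in> q ` ({j. z j = z'} - {..<k})"
      then obtain j where n: "n = q j" and j: "j \<notin> {..<k}" "z' = z j"
        by auto
      have "val j (q j) = z j"
        unfolding val_def g_def by simp
      then have "fits S (q j) z'"
        using fits_mono[OF fits[OF q_lev] S_sub] j by (metis lessThan_iff not_le)
      then show "n \<in> {n. fits S n x}"
        using z'(2) unfolding fits_def n by force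
    qed
    ultimately show "infinite {n. fits S n x}"
      using infinite_super by blast
  qed
  moreover have "compatible (insert (c, a) H) (E k)" for k
  proof -
    \<comment> \<open>From level \<open>k\<close> on, related points lie in one level and in one cell of that level.\<close>
    have "E k \<inter> a \<times> - a \<subseteq> (- V k) \<times> (E k `` (- V k))"
    proof (rule ccontr)
      assume "\<not> ?thesis"
      then obtain n m where nm: "(n, m) \<in> E k" "n \<in> a" "m \<notin> a" "n \<in> V k"
        by auto
      then obtain j where j: "j \<ge> k" "n \<in> lev j"
        using lev_ex by blast
      then have E_nm: "(n, m) \<in> E j" "(m, n) \<in> E (Suc j)"
        using nm E_mono'[of k j] E_mono'[of k "Suc j"] E_sym[of k] by (auto dest: symD)
      then have "m \<in> lev j"
        using j V_cl[of j] V_cl[of "Suc j"] unfolding lev_def by blast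
      moreover have "val j n = val j m"
        unfolding val_def using equiv_class_eq[OF E_equiv E_nm(1)] by simp
      ultimately show False
        using nm a_iff j by metis
    qed
    then have "finite (E k \<inter> a \<times> - a)"
      using V_fin bounded_cells_finite_Image[OF E] by (meson finite_SigmaI finite_subset)
    then show ?thesis
      using comp unfolding compatible_def by auto
  qed
  ultimately show ?thesis
    by blast
qed

text \<open>An undetermined \<open>b\<close> yields, at every level \<open>k\<close>, points \<open>x k \<in> b\<close> and \<open>y k \<notin> b\<close> on which all
  labels in \<open>T k\<close> agree: otherwise \<open>T k\<close> would determine \<open>b\<close>. Gluing the cells of \<open>x k\<close> and \<open>y k\<close> for
  all \<open>k\<close> splits \<open>b\<close> infinitely often, but a given label only finitely often. The cells of \<open>G n\<close> stay
  bounded because only two cells of \<open>E n\<close> are glued at each level from \<open>n\<close> on, while the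
  finitely many points before level \<open>n\<close>, where \<open>E n\<close> may cross levels, form a single cell.\<close>

lemma destroy_undetermined_set:
  fixes E :: "nat \<Rightarrow> nat rel" and H :: "('a set \<times> nat set) set"
  assumes H: "countable H"
    and E: "\<And>k. bounded_cells (E k)" and E_mono: "\<And>k. E k \<subseteq> E (Suc k)"
    and comp: "\<And>k. compatible H (E k)"
    and b: "\<And>T. finite T \<Longrightarrow> T \<subseteq> H \<Longrightarrow> \<not> determined_by T b"
  shows "\<exists>G. (\<forall>k. bounded_cells (G k) \<and> compatible H (G k) \<and> E k \<subseteq> G k \<and> G k \<subseteq> G (Suc k)) \<and>
             infinite (G 0 \<inter> b \<times> - b)"
proof -
  obtain T :: "nat \<Rightarrow> ('a set \<times> nat set) set" where T: "\<And>k. finite (T k)" "\<And>k. T k \<subseteq> H" "\<And>j k. j \<le> k \<Longrightarrow> T j \<subseteq> T k"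
    "\<And>F. finite F \<Longrightarrow> F \<subseteq> H \<Longrightarrow> \<exists>k. F \<subseteq> T k"
    by (rule finite_exhaustion[OF H], rule that)
  have B_fin: "finite (split_points (T k) (E k))" for k
    using finite_split_points[OF T(1,2) comp] .
  let ?P = "\<lambda>k W. \<exists>x y. W = {x, y} \<and> x \<in> b \<and> y \<notin> b \<and> same_labels (T k) x y"
  have pair_ex: "\<exists>W. finite W \<and> W \<inter> F = {} \<and> ?P k W" if F: "finite F" for k F
  proof -
    obtain x y where "x \<notin> F" "y \<notin> F" "same_labels (T k) x y" "x \<in> b" "y \<notin> b"
      using not_determined_by[OF b[OF T(1,2)] F] by blast
    then show ?thesis
      by (intro exI[of _ "{x, y}"]) auto
  qed
  obtain V W where V_dec: "\<And>k. V (Suc k) \<subseteq> V k" and V_fin: "\<And>k. finite (- V k)"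
    and V_cl: "\<And>k. E k `` V k \<subseteq> V k" and VB: "\<And>k. V k \<inter> split_points (T k) (E k) = {}"
    and W: "\<And>k. ?P k (W k)" and W_lev: "\<And>k. E k `` W k \<subseteq> V k - V (Suc k)"
    by (rule exists_levels[where E = E and B = "\<lambda>k. split_points (T k) (E k)" and P = ?P,
          OF E E_mono B_fin pair_ex], assumption, rule that)
  obtain x y where xy: "\<And>k. W k = {x k, y k}" "\<And>k. x k \<in> b" "\<And>k. y k \<notin> b"
    "\<And>k. same_labels (T k) (x k) (y k)"
    using W by metis
  have E_equiv: "equiv UNIV (E k)" for k
    using E by (rule bounded_cells_equiv)
  have E_sym: "sym (E k)" and E_trans: "trans (E k)" for k
    using E_equiv by (simp_all add: equiv_def)
  have E_refl: "(u, u) \<in> E k" for u k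
    using E_equiv[of k] by (simp add: equiv_def refl_on_def)
  have E_mono': "E j \<subseteq> E k" if "j \<le> k" for j k
    using lift_Suc_mono_le[of E, OF E_mono that] .
  have V_anti: "V k \<subseteq> V j" if "j \<le> k" for j k
    using lift_Suc_antimono_le[of V, OF V_dec that] .
  define blk where "blk n k = E n `` {x k, y k}" for n k
  have blk_lev: "blk n k \<subseteq> V k - V (Suc k)" if "n \<le> k" for n k
    using W_lev[of k] E_mono'[OF that] xy(1)[of k] unfolding blk_def by blast
  have blk_disj: "j = k" if "blk n j \<inter> blk n k \<noteq> {}" "n \<le> j" "n \<le> k" for n j k
  proof (rule ccontr)
    have less: "blk n i \<inter> blk n l = {}" if "n \<le> i" "i < l" for i l
      using blk_lev[of n i] blk_lev[of n l] V_anti[of "Suc i" l] that by fastforce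
    assume "j \<noteq> k"
    then show False
      using less[of j k] less[of k j] that by (auto simp: nat_neq_iff)
  qed
  define \<D> where "\<D> n = insert (- V n) (blk n ` {n..})" for n
  define G where "G n = E n \<union> (\<Union>D\<in>\<D> n. D \<times> D)" for n
  have G_cells: "bounded_cells (G n)" for n
  proof -
    obtain N where N: "\<And>u. finite (E n `` {u}) \<and> card (E n `` {u}) \<le> N"
      using E unfolding bounded_cells_def by blast
    show ?thesis
      unfolding G_def
    proof (rule merge_cells[OF E, where M = "max (N + N) (card (- V n))"])
      show "E n `` D \<subseteq> D" if D: "D \<in> \<D> n" for D
      proof (cases "D = - V n")
        case True
        then show ?thesis
          using V_cl[of n] E_sym[of n] by (auto dest: symD)
      next
        case False
        then show ?thesis
          using D E_trans[of n] unfolding \<D>_def blk_def by (auto dest: transD)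
      qed
      have "blk n k \<inter> (- V n) = {}" if "n \<le> k" for k
        using blk_lev[OF that] V_anti[OF that] by blast
      then have V_blk: "- V n \<inter> blk n k = {}" if "n \<le> k" for k
        using that by blast
      show "D = D'" if DD': "D \<in> \<D> n" "D' \<in> \<D> n" "D \<inter> D' \<noteq> {}" for D D'
        using DD'(1,2) unfolding \<D>_def
      proof (elim insertE imageE)
        fix j k assume "D = blk n j" "D' = blk n k" "j \<in> {n..}" "k \<in> {n..}"
        then show ?thesis
          using DD'(3) blk_disj[of n j k] by simp
      qed (use DD'(3) V_blk in auto)
      have "finite (blk n k) \<and> card (blk n k) \<le> N + N" for k
      proof -
        have "blk n k = E n `` {x k} \<union> E n `` {y k}"
          unfolding blk_def by auto
        then show ?thesis
          using N[of "x k"] N[of "y k"] card_Un_le[of "E n `` {x k}" "E n `` {y k}"] by simp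
      qed
      then show "finite D \<and> card D \<le> max (N + N) (card (- V n))" if "D \<in> \<D> n" for D
        using that V_fin[of n] unfolding \<D>_def by (auto simp: le_max_iff_disj)
    qed
  qed
  have G_mono: "G n \<subseteq> G (Suc n)" for n
  proof -
    have "\<exists>D'\<in>\<D> (Suc n). D \<subseteq> D'" if D: "D \<in> \<D> n" for D
    proof -
      have "D = - V n \<or> (\<exists>k\<ge>n. D = blk n k)"
        using D unfolding \<D>_def by auto
      then consider "D = - V n" | "D = blk n n" | k where "Suc n \<le> k" "D = blk n k"
        by (metis le_antisym not_less_eq_eq)
      then show ?thesis
      proof cases
        case 3
        then have "D \<subseteq> blk (Suc n) k"
          using E_mono[of n] unfolding blk_def by blast
        then show ?thesis
          using 3 unfolding \<D>_def by auto
      qed (use V_dec[of n] blk_lev[of n n] in \<open>auto simp: \<D>_def\<close>)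
    qed
    then have "(\<Union>D\<in>\<D> n. D \<times> D) \<subseteq> (\<Union>D\<in>\<D> (Suc n). D \<times> D)"
      by (intro UN_least) (meson Sigma_mono UN_upper subset_trans)
    then show ?thesis
      unfolding G_def by (rule Un_mono[OF E_mono])
  qed
  have G_comp: "compatible H (G n)" for n
    unfolding compatible_def
  proof clarify
    fix t a assume "(t, a) \<in> H"
    then obtain k0 where "(t, a) \<in> T k0"
      using T(4)[of "{(t, a)}"] by auto
    define k1 where "k1 = max k0 n"
    \<comment> \<open>Blocks at late levels lie on one side of \<open>a\<close>.\<close>
    have late: "u \<in> a \<longleftrightarrow> x k \<in> a" if u: "u \<in> blk n k" and k: "k1 \<le> k" for u k
    proof -
      have ta: "(t, a) \<in> T k"
        using \<open>(t, a) \<in> T k0\<close> T(3)[of k0 k] k unfolding k1_def by auto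
      obtain w where w: "w \<in> {x k, y k}" "(w, u) \<in> E k"
        using u E_mono'[of n k] k unfolding blk_def k1_def by auto
      then have "w \<in> V k"
        using W_lev[of k] xy(1)[of k] E_refl by blast
      then have "same_labels (T k) w u"
        using same_labels_outside_split_points[OF E_sym w(2)] VB[of k] by blast
      then show ?thesis
        using ta w(1) xy(4)[of k] unfolding same_labels_def by blast
    qed
    have "G n \<inter> a \<times> - a \<subseteq> E n \<inter> a \<times> - a \<union> (- V n) \<times> (- V n) \<union> (\<Union>k\<in>{..<k1}. blk n k \<times> blk n k)"
    proof (rule subrelI)
      fix u v assume uv: "(u, v) \<in> G n \<inter> a \<times> - a"
      have "k < k1" if "u \<in> blk n k" "v \<in> blk n k" for k
        using uv late[OF that(1)] late[OF that(2)] by (cases "k1 \<le> k") auto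
      then show "(u, v) \<in> E n \<inter> a \<times> - a \<union> (- V n) \<times> (- V n) \<union> (\<Union>k\<in>{..<k1}. blk n k \<times> blk n k)"
        using uv unfolding G_def \<D>_def by auto
    qed
    moreover have "finite (E n \<inter> a \<times> - a)"
      using comp[of n] \<open>(t, a) \<in> H\<close> unfolding compatible_def by blast
    moreover have "finite (blk n k)" for k
      unfolding blk_def using bounded_cells_finite_Image[OF E] by simp
    ultimately show "finite (G n \<inter> a \<times> - a)"
      using V_fin[of n] by (elim finite_subset) (intro finite_UnI finite_UN_I finite_cartesian_product; simp)
  qed
  have "infinite (range (\<lambda>k. (x k, y k)))"
  proof (rule range_inj_infinite, rule injI)
    fix j k assume "(x j, y j) = (x k, y k)"
    then have "blk 0 j \<inter> blk 0 k \<noteq> {}"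
      using E_refl unfolding blk_def by blast
    then show "j = k"
      using blk_disj[of 0 j k] by simp
  qed
  moreover have "range (\<lambda>k. (x k, y k)) \<subseteq> G 0 \<inter> b \<times> - b"
  proof (rule image_subsetI)
    fix k
    have "blk 0 k \<in> \<D> 0" "x k \<in> blk 0 k" "y k \<in> blk 0 k"
      using E_refl unfolding \<D>_def blk_def by auto
    then show "(x k, y k) \<in> G 0 \<inter> b \<times> - b"
      using xy(2,3) unfolding G_def by blast
  qed
  ultimately have "infinite (G 0 \<inter> b \<times> - b)"
    by (rule infinite_super[rotated])
  moreover have "E n \<subseteq> G n" for n
    unfolding G_def by blast
  ultimately show ?thesis
    using G_cells G_mono G_comp by (intro exI[of _ G]) simp
qed


section \<open>Saturated schemes\<close>

text \<open>The conditions of the recursion: labels \<open>H\<close> for members of \<open>\<U>\<close> together with finitary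
  equivalence relations \<open>R\<close>, directed under inclusion, that respect the labels.\<close>

definition scheme :: "'a set \<Rightarrow> 'a set set \<Rightarrow> ('a set \<times> nat set) set \<Rightarrow> nat rel set \<Rightarrow> bool" where
  "scheme X \<U> H R \<longleftrightarrow>
     approximation X H \<and> fst ` H \<subseteq> \<U> \<and>
     (\<forall>E\<in>R. bounded_cells E \<and> compatible H E) \<and> (\<forall>E\<in>R. \<forall>F\<in>R. \<exists>G\<in>R. E \<union> F \<subseteq> G)"

lemma schemeD:
  assumes "scheme X \<U> H R"
  shows "approximation X H" "fst ` H \<subseteq> \<U>" "E \<in> R \<Longrightarrow> bounded_cells E" "E \<in> R \<Longrightarrow> compatible H E"
    "E \<in> R \<Longrightarrow> F \<in> R \<Longrightarrow> \<exists>G\<in>R. E \<union> F \<subseteq> G"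
  using assms unfolding scheme_def by simp_all

text \<open>First \<open>c\<close> is labelled. If afterwards \<open>b\<close> is still not determined by the labels, then a relation
  that splits \<open>b\<close> infinitely often is added. All labels added later are
  compatible with that relation, so \<open>b\<close> can never become determined again.\<close>

lemma scheme_step:
  assumes S: "scheme X \<U> H R" "countable H" "countable R" "R \<noteq> {}" and "X \<noteq> {}" "c \<in> \<U>"
  shows "\<exists>H' R'. H \<subseteq> H' \<and> R \<subseteq> R' \<and> countable H' \<and> countable R' \<and> scheme X \<U> H' R' \<and>
           (\<exists>a. (c, a) \<in> H') \<and>
           ((\<exists>T. finite T \<and> T \<subseteq> H' \<and> determined_by T b) \<or> (\<exists>E\<in>R'. infinite (E \<inter> b \<times> - b)))"
proof -
  note H = schemeD(1)[OF S(1)] and cells = schemeD(3)[OF S(1)] and comp = schemeD(4)[OF S(1)]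
    and R = schemeD(5)[OF S(1)]
  have "\<exists>E. (\<forall>k. E k \<in> R) \<and> (\<forall>k. E k \<subseteq> E (Suc k)) \<and> (\<forall>F\<in>R. \<exists>k. F \<subseteq> E k)"
    using S(3,4) R by (rule cofinal_sequence_of_relations)
  then obtain E where E: "\<forall>k. E k \<in> R" "\<forall>k. E k \<subseteq> E (Suc k)" "\<forall>F\<in>R. \<exists>k. F \<subseteq> E k"
    by (elim exE conjE) (rule that)
  have E_cells: "bounded_cells (E k)" and E_comp: "compatible H (E k)" and E_mono: "E k \<subseteq> E (Suc k)" for k
    using E cells comp by auto
  obtain a where a: "approximation X (insert (c, a) H)" "\<forall>k. compatible (insert (c, a) H) (E k)"
    using extend_approximation[where E = E and c = c, OF H S(2) E_cells E_mono E_comp \<open>X \<noteq> {}\<close>]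
    by (elim exE conjE) (rule that)
  let ?H = "insert (c, a) H"
  have comp': "compatible ?H F" if F: "F \<in> R" for F
  proof -
    obtain k where "F \<subseteq> E k"
      using E(3) F by blast
    then have "F \<inter> u \<times> - u \<subseteq> E k \<inter> u \<times> - u" for u
      by blast
    then show ?thesis
      using a(2) unfolding compatible_def by (meson finite_subset)
  qed
  have H': "fst ` ?H \<subseteq> \<U>" "countable ?H"
    using S(2) schemeD(2)[OF S(1)] \<open>c \<in> \<U>\<close> by auto
  show ?thesis
  proof (cases "\<exists>T. finite T \<and> T \<subseteq> ?H \<and> determined_by T b")
    case True
    have "scheme X \<U> ?H R"
      unfolding scheme_def using a(1) H' cells comp' R by simp
    with True show ?thesis
      using S(3) H'(2) by (intro exI[of _ ?H] exI[of _ R]) auto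
  next
    case False
    have E_comp': "compatible ?H (E k)" for k
      using a(2) by simp
    have undet: "\<not> determined_by T b" if "finite T" "T \<subseteq> ?H" for T
      using False that by simp
    have "\<exists>G. (\<forall>k. bounded_cells (G k) \<and> compatible ?H (G k) \<and> E k \<subseteq> G k \<and> G k \<subseteq> G (Suc k)) \<and>
        infinite (G 0 \<inter> b \<times> - b)"
      using H'(2) E_cells E_mono E_comp' undet by (rule destroy_undetermined_set)
    then obtain G where G: "\<forall>k. bounded_cells (G k) \<and> compatible ?H (G k) \<and> E k \<subseteq> G k \<and> G k \<subseteq> G (Suc k)"
      and inf: "infinite (G 0 \<inter> b \<times> - b)"
      by (elim exE conjE) (rule that)
    have G_mono: "G j \<subseteq> G k" if "j \<le> k" for j k
      using lift_Suc_mono_le[of G j k] G that by simp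
    have below: "\<exists>k. F \<subseteq> G k" if F: "F \<in> R \<union> range G" for F
    proof (cases "F \<in> R")
      case True
      then obtain k where "F \<subseteq> E k"
        using E(3) by blast
      then show ?thesis
        using G by (meson subset_trans)
    qed (use F in auto)
    have "\<exists>G'\<in>R \<union> range G. F \<union> F' \<subseteq> G'" if FF': "F \<in> R \<union> range G" "F' \<in> R \<union> range G" for F F'
    proof -
      obtain j k where "F \<subseteq> G j" "F' \<subseteq> G k"
        using below FF' by meson
      then have "F \<union> F' \<subseteq> G (max j k)"
        using G_mono[of j "max j k"] G_mono[of k "max j k"] by auto
      then show ?thesis
        by (intro bexI[of _ "G (max j k)"]) auto
    qed
    then have "scheme X \<U> ?H (R \<union> range G)"
      unfolding scheme_def using a(1) H' cells comp' G by auto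
    moreover have "\<exists>F\<in>R \<union> range G. infinite (F \<inter> b \<times> - b)"
      using inf by blast
    moreover have "countable (R \<union> range G)"
      using S(3) by simp
    ultimately show ?thesis
      using H'(2) by (intro exI[of _ ?H] exI[of _ "R \<union> range G"]) auto
  qed
qed

text \<open>Every clause of \<open>scheme\<close> concerns finitely many labels and relations, and these lie in one
  member of the chain. A pair of sets is coded as a subset of a sum type, so that extension
  of conditions is inclusion and their limit is the union.\<close>

lemma scheme_Union_chain:
  fixes \<C> :: "(('a set \<times> nat set) + nat rel) set set"
  assumes "\<C> \<noteq> {}" and chain: "\<And>P P'. P \<in> \<C> \<Longrightarrow> P' \<in> \<C> \<Longrightarrow> P \<subseteq> P' \<or> P' \<subseteq> P"
    and S: "\<And>P. P \<in> \<C> \<Longrightarrow> scheme X \<U> (Inl -` P) (Inr -` P)"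
  shows "scheme X \<U> (Inl -` \<Union>\<C>) (Inr -` \<Union>\<C>)"
proof -
  have chain': "subset.chain UNIV \<C>"
    unfolding subset.chain_def using chain by auto
  have sub: "\<exists>P\<in>\<C>. A \<subseteq> P" if A: "finite A" "A \<subseteq> \<Union>\<C>" for A
    by (rule finite_subset_Union_chain[OF A \<open>\<C> \<noteq> {}\<close> chain']) (rule bexI)
  note app = schemeD(1)[OF S] and lab = schemeD(2)[OF S] and cells = schemeD(3)[OF S]
    and comp = schemeD(4)[OF S] and dir = schemeD(5)[OF S]
  show ?thesis
    unfolding scheme_def
  proof (intro conjI ballI)
    show "approximation X (Inl -` \<Union>\<C>)"
      unfolding approximation_def
    proof (intro allI impI)
      fix T :: "('a set \<times> nat set) set" assume T: "finite T \<and> T \<subseteq> Inl -` \<Union>\<C>"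
      then have "finite (Inl ` T :: (('a set \<times> nat set) + nat rel) set)" "Inl ` T \<subseteq> \<Union>\<C>"
        by auto
      from sub[OF this] obtain P where P: "P \<in> \<C>" "Inl ` T \<subseteq> P"
        by (elim bexE) (rule that)
      then have "finite T" "T \<subseteq> Inl -` P"
        using T by auto
      then show "(\<forall>z\<in>X. infinite {n. fits T n z}) \<and> finite {n. \<nexists>z. z \<in> X \<and> fits T n z}"
        using app[OF P(1)] unfolding approximation_def by simp
    qed
    show "fst ` (Inl -` \<Union>\<C>) \<subseteq> \<U>"
      using lab by blast
    fix E assume E: "E \<in> Inr -` \<Union>\<C>"
    then show "bounded_cells E"
      using cells by blast
    show "compatible (Inl -` \<Union>\<C>) E"
      unfolding compatible_def
    proof (intro allI impI)
      fix t a assume "(t, a) \<in> Inl -` \<Union>\<C>"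
      then have "finite {Inl (t, a), Inr E}" "{Inl (t, a), Inr E} \<subseteq> \<Union>\<C>"
        using E by auto
      from sub[OF this] obtain P where "P \<in> \<C>" "{Inl (t, a), Inr E} \<subseteq> P"
        by (elim bexE) (rule that)
      then show "finite (E \<inter> a \<times> - a)"
        using comp[of P E] unfolding compatible_def by auto
    qed
    fix F assume F: "F \<in> Inr -` \<Union>\<C>"
    have "finite {Inr E, Inr F :: ('a set \<times> nat set) + nat rel}" "{Inr E, Inr F} \<subseteq> \<Union>\<C>"
      using E F by auto
    from sub[OF this] obtain P where P: "P \<in> \<C>" "{Inr E, Inr F} \<subseteq> P"
      by (elim bexE) (rule that)
    then obtain G where "G \<in> Inr -` P" "E \<union> F \<subseteq> G"
      using dir[OF P(1), of E F] by auto
    then show "\<exists>G\<in>Inr -` \<Union>\<C>. E \<union> F \<subseteq> G"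
      using P(1) by blast
  qed
qed

lemma bounded_cells_initial: "bounded_cells (Id \<union> {..n} \<times> {..n})"
proof -
  have "bounded_cells Id"
    unfolding bounded_cells_def equiv_def by (auto simp: refl_on_def sym_Id trans_Id intro!: exI[of _ 1])
  then have "bounded_cells (Id \<union> (\<Union>D\<in>{{..n}}. D \<times> D))"
    by (rule merge_cells[where M = "Suc n"]) auto
  then show ?thesis
    by simp
qed

text \<open>The recursion treats, at the stage of \<open>b\<close>, both the set \<open>b\<close> itself and the member \<open>g b\<close> of
  the family to be labelled.\<close>

lemma exists_saturated_scheme:
  fixes X :: "'a set" and g :: "nat set \<Rightarrow> 'a set" and r :: "nat set rel"
  assumes X: "X \<noteq> {}"
    and r: "wf r" "trans r" "total r" "\<And>b. countable {b'. (b', b) \<in> r}"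
  shows "\<exists>H R. scheme X (range g) H R \<and> (\<forall>n. \<exists>E\<in>R. {..n} \<times> {..n} \<subseteq> E) \<and>
           (\<forall>b. \<exists>a. (g b, a) \<in> H) \<and>
           (\<forall>b. (\<exists>T. finite T \<and> T \<subseteq> H \<and> determined_by T b) \<or> (\<exists>E\<in>R. infinite (E \<inter> b \<times> - b)))"
proof -
  let ?good = "\<lambda>P :: (('a set \<times> nat set) + nat rel) set. scheme X (range g) (Inl -` P) (Inr -` P)"
  let ?D = "\<lambda>b P. (\<exists>a. Inl (g b, a) \<in> P) \<and>
    ((\<exists>T. finite T \<and> T \<subseteq> Inl -` P \<and> determined_by T b) \<or> (\<exists>E. Inr E \<in> P \<and> infinite (E \<inter> b \<times> - b)))"
  \<comment> \<open>With these relations in the first stage, finite sets are bounded in the resulting coarse space.\<close>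
  define P0 :: "(('a set \<times> nat set) + nat rel) set"
    where "P0 = Inr ` range (\<lambda>n. Id \<union> {..n} \<times> {..n})"
  have P0_parts: "Inl -` P0 = {}" "Inr -` P0 = range (\<lambda>n. Id \<union> {..n} \<times> {..n})"
    unfolding P0_def by auto
  have base: "?good P0"
    unfolding P0_parts scheme_def
  proof (intro conjI ballI)
    show "approximation X {}"
      using X unfolding approximation_def fits_def by auto
    fix E :: "nat rel" assume E: "E \<in> range (\<lambda>n. Id \<union> {..n} \<times> {..n})"
    then show "bounded_cells E"
      using bounded_cells_initial by blast
    show "compatible {} E"
      unfolding compatible_def by simp
    fix F :: "nat rel" assume F: "F \<in> range (\<lambda>n. Id \<union> {..n} \<times> {..n})"
    obtain i j where "E = Id \<union> {..i} \<times> {..i}" "F = Id \<union> {..j} \<times> {..j}"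
      using E F by blast
    then have "E \<union> F \<subseteq> Id \<union> {..max i j} \<times> {..max i j}"
      by auto
    then show "\<exists>G\<in>range (\<lambda>n. Id \<union> {..n} \<times> {..n}). E \<union> F \<subseteq> G"
      by blast
  qed simp
  have base_countable: "countable P0"
    unfolding P0_def by simp
  have step: "\<exists>P'. P \<subseteq> P' \<and> ?good P' \<and> countable P' \<and> ?D b P'"
    if P: "?good P" "countable P" "P0 \<subseteq> P" for b P
  proof -
    have "Inl ` (Inl -` P) \<subseteq> P" "Inr ` (Inr -` P) \<subseteq> P"
      by auto
    then have ctbl: "countable (Inl -` P)" "countable (Inr -` P)"
      using P(2) by (meson countable_subset countable_image_inj_on inj_Inl inj_Inr inj_on_subset subset_UNIV)+
    have "Inr -` P \<noteq> {}"
      using P(3) unfolding P0_def by blast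
    from scheme_step[OF P(1) ctbl this X rangeI, of b b]
    obtain H R a where HR: "Inl -` P \<subseteq> H" "Inr -` P \<subseteq> R" "countable H" "countable R"
      "scheme X (range g) H R" "(g b, a) \<in> H"
      "(\<exists>T. finite T \<and> T \<subseteq> H \<and> determined_by T b) \<or> (\<exists>E\<in>R. infinite (E \<inter> b \<times> - b))"
      by (elim exE conjE) (rule that)
    define P' where "P' = Inl ` H \<union> Inr ` R"
    have parts: "Inl -` P' = H" "Inr -` P' = R"
      unfolding P'_def by auto
    have "P \<subseteq> P'"
    proof
      fix p assume p: "p \<in> P"
      show "p \<in> P'"
        using HR(1,2) p unfolding P'_def by (cases p) auto
    qed
    moreover have "countable P'"
      using HR(3,4) unfolding P'_def by simp
    moreover have "?D b P'"
      using HR(6,7) unfolding parts vimage_eq[symmetric] by auto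
    ultimately show ?thesis
      using HR(5) parts by (intro exI[of _ P']) simp
  qed
  have mono: "?D b P'" if "?D b P" "P \<subseteq> P'" for b P P'
    using that by (meson subset_trans subsetD vimage_mono)
  have "\<exists>Q. P0 \<subseteq> Q \<and> ?good Q \<and> (\<forall>b. ?D b Q)"
  proof (rule countable_stage_recursion[where r = r])
    show "?good (\<Union>\<C>)" if "\<C> \<noteq> {}"
      "\<And>P P'. P \<in> \<C> \<Longrightarrow> P' \<in> \<C> \<Longrightarrow> P \<subseteq> P' \<or> P' \<subseteq> P" "\<And>P. P \<in> \<C> \<Longrightarrow> ?good P" for \<C>
      using that by (rule scheme_Union_chain)
  qed (fact r base base_countable step mono)+
  then obtain Q where Q: "P0 \<subseteq> Q" "?good Q" "\<forall>b. ?D b Q"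
    by (elim exE conjE) (rule that)
  have "\<exists>E\<in>Inr -` Q. {..n} \<times> {..n} \<subseteq> E" for n
  proof (rule bexI)
    show "Id \<union> {..n} \<times> {..n} \<in> Inr -` Q"
      using Q(1) unfolding P0_def by auto
  qed simp
  moreover have "\<exists>a. (g b, a) \<in> Inl -` Q"
    "(\<exists>T. finite T \<and> T \<subseteq> Inl -` Q \<and> determined_by T b) \<or> (\<exists>E\<in>Inr -` Q. infinite (E \<inter> b \<times> - b))" for b
    using Q(3) by auto
  ultimately show ?thesis
    using Q(2) by (intro exI[of _ "Inl -` Q"] exI[of _ "Inr -` Q"]) simp
qed


section \<open>The coarse space of a saturated scheme\<close>

definition generated_coarse_structure :: "nat rel set \<Rightarrow> nat rel set" where
  "generated_coarse_structure R = {E. Id \<subseteq> E \<and> (\<exists>F\<in>R. E \<subseteq> F)}"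

text \<open>Saturation is the dichotomy \<open>decided\<close>: a set of naturals is a Boolean combination of labels up to
  a finite set, or it is split infinitely often by a relation in \<open>R\<close>.\<close>

locale saturated_scheme =
  fixes K :: "'a topology" and H :: "('a set \<times> nat set) set" and R :: "nat rel set"
  assumes compact: "compact_space K" and Hausdorff: "Hausdorff_space K" and dim: "K dim_le 0"
    and scheme: "scheme (topspace K) {U. openin K U \<and> closedin K U} H R"
    and initial: "\<And>n. \<exists>E\<in>R. {..n} \<times> {..n} \<subseteq> E"
    and labelled: "\<And>U. openin K U \<Longrightarrow> closedin K U \<Longrightarrow> \<exists>a. (U, a) \<in> H"
    and decided: "\<And>b. (\<exists>T. finite T \<and> T \<subseteq> H \<and> determined_by T b) \<or> (\<exists>E\<in>R. infinite (E \<inter> b \<times> - b))"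
begin

abbreviation \<E> :: "nat rel set" where
  "\<E> \<equiv> generated_coarse_structure R"

lemma in_coarse: "E \<in> R \<Longrightarrow> E \<in> \<E>"
  using bounded_cells_equiv[OF schemeD(3)[OF scheme]]
  unfolding generated_coarse_structure_def equiv_def refl_on_def by fastforce

lemma coarse_below: "E \<in> \<E> \<Longrightarrow> \<exists>F\<in>R. E \<subseteq> F"
  unfolding generated_coarse_structure_def by simp

lemma coarse_refl: "E \<in> \<E> \<Longrightarrow> (x, x) \<in> E"
  unfolding generated_coarse_structure_def by auto

lemma coarse: "coarse_space UNIV \<E>"
  unfolding coarse_space_def
proof (intro conjI ballI allI impI)
  show "entourage_on UNIV E" if "E \<in> \<E>" for E
    using that coarse_refl unfolding entourage_on_def by auto
  show "\<Union>\<E> = UNIV \<times> UNIV"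
  proof -
    have "(x, y) \<in> \<Union>\<E>" for x y
    proof -
      obtain E where "E \<in> R" "{..max x y} \<times> {..max x y} \<subseteq> E"
        using initial by blast
      moreover have "(x, y) \<in> {..max x y} \<times> {..max x y}"
        by simp
      ultimately show ?thesis
        using in_coarse by blast
    qed
    then show ?thesis
      by auto
  qed
  show "\<exists>G\<in>\<E>. E O F\<inverse> \<subseteq> G" if EF: "E \<in> \<E>" "F \<in> \<E>" for E F
  proof -
    obtain E' F' where E': "E' \<in> R" "E \<subseteq> E'" and F': "F' \<in> R" "F \<subseteq> F'"
      using coarse_below EF by meson
    obtain G where G: "G \<in> R" "E' \<union> F' \<subseteq> G"
      using schemeD(5)[OF scheme E'(1) F'(1)] by blast
    have "sym G" "trans G"
      using bounded_cells_equiv[OF schemeD(3)[OF scheme G(1)]] by (simp_all add: equiv_def)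
    then have "E O F\<inverse> \<subseteq> G"
      using E'(2) F'(2) G(2) unfolding sym_def trans_def by blast
    then show ?thesis
      using in_coarse[OF G(1)] by blast
  qed
  show "E \<in> \<E>" if FE: "F \<in> \<E>" "Id_on UNIV \<subseteq> E \<and> E \<subseteq> F" for F E
  proof -
    obtain F' where "F' \<in> R" "F \<subseteq> F'"
      using coarse_below[OF FE(1)] by blast
    moreover from this have "E \<subseteq> F'"
      using FE(2) by auto
    moreover have "Id \<subseteq> E"
      using FE(2) by (auto simp: Id_on_def)
    ultimately show ?thesis
      unfolding generated_coarse_structure_def by auto
  qed
qed

lemma finitary: "finitary UNIV \<E>"
  unfolding finitary_def
proof
  fix E assume "E \<in> \<E>"
  then obtain F where F: "F \<in> R" "E \<subseteq> F"
    using coarse_below by blast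
  obtain N where N: "\<forall>x. finite (F `` {x}) \<and> card (F `` {x}) \<le> N"
    using schemeD(3)[OF scheme F(1)] unfolding bounded_cells_def by blast
  have "finite (E `` {x}) \<and> card (E `` {x}) \<le> N" for x
  proof -
    have "E `` {x} \<subseteq> F `` {x}"
      using F(2) by blast
    then show ?thesis
      using N by (meson card_mono finite_subset le_trans)
  qed
  then show "\<exists>n. \<forall>x\<in>UNIV. finite (E `` {x}) \<and> card (E `` {x}) \<le> n"
    by blast
qed

lemma cellular: "cellular UNIV \<E>"
  unfolding cellular_def
  using coarse_below in_coarse bounded_cells_equiv[OF schemeD(3)[OF scheme]] by meson

lemma bounded_iff_finite: "coarse_bounded UNIV \<E> B \<longleftrightarrow> finite B"
proof
  assume "coarse_bounded UNIV \<E> B"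
  then obtain E x where "E \<in> \<E>" "B \<subseteq> E `` {x}"
    unfolding coarse_bounded_def by blast
  then show "finite B"
    using finitary unfolding finitary_def by (meson UNIV_I finite_subset)
next
  assume "finite B"
  then obtain n where n: "B \<subseteq> {..n}"
    using finite_nat_iff_bounded_le by blast
  obtain E where "E \<in> R" "{..n} \<times> {..n} \<subseteq> E"
    using initial by blast
  then have "E \<in> \<E>" "B \<subseteq> E `` {0}"
    using n in_coarse by auto
  then show "coarse_bounded UNIV \<E> B"
    unfolding coarse_bounded_def by blast
qed

abbreviation SO :: "(nat \<Rightarrow> real) set" where
  "SO \<equiv> slowly_oscillating2 UNIV \<E>"

text \<open>Slow oscillation of the indicator of \<open>b\<close> means that each relation in \<open>R\<close> splits \<open>b\<close> only finitely
  often, as bounded sets are finite and the diameter of a subset of \<open>{0, 1}\<close> below \<open>1\<close> is \<open>0\<close>.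
  Determined sets have this property since the labels do, and the others lack it by saturation.\<close>

lemma SO_iff:
  "\<phi> \<in> SO \<longleftrightarrow> (\<exists>b. \<phi> = indicator b \<and> (\<exists>T. finite T \<and> T \<subseteq> H \<and> determined_by T b))"
proof
  assume SO: "\<phi> \<in> SO"
  define b where "b = {n. \<phi> n = 1}"
  have range01: "\<phi> n = 0 \<or> \<phi> n = 1" for n
    using SO unfolding slowly_oscillating2_def by (auto simp: PiE_iff)
  then have \<phi>: "\<phi> = indicator b"
    unfolding b_def by (intro ext) (auto simp: indicator_def)
  have "finite (E \<inter> b \<times> - b)" if E: "E \<in> R" for E
  proof -
    have "\<exists>B. coarse_bounded UNIV \<E> B \<and> (\<forall>x\<in>UNIV - B. diameter (\<phi> ` (E `` {x})) < 1)"
      using SO in_coarse[OF E] unfolding slowly_oscillating2_def by auto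
    then obtain B where B: "finite B" "\<And>x. x \<notin> B \<Longrightarrow> diameter (\<phi> ` (E `` {x})) < 1"
      using bounded_iff_finite by auto
    have "x \<in> B" if xy: "(x, y) \<in> E" "x \<in> b" "y \<notin> b" for x y
    proof (rule ccontr)
      assume "x \<notin> B"
      have "finite (\<phi> ` (E `` {x}))"
        using bounded_cells_finite[OF schemeD(3)[OF scheme E]] by simp
      then have "dist (\<phi> x) (\<phi> y) \<le> diameter (\<phi> ` (E `` {x}))"
        using coarse_refl[OF in_coarse[OF E]] xy(1) by (intro diameter_bounded_bound finite_imp_bounded) auto
      then show False
        using B(2)[OF \<open>x \<notin> B\<close>] xy(2,3) by (simp add: \<phi> dist_real_def)
    qed
    then have "E \<inter> b \<times> - b \<subseteq> B \<times> E `` B"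
      by auto
    then show ?thesis
      using B(1) bounded_cells_finite_Image[OF schemeD(3)[OF scheme E] B(1)]
      by (meson finite_SigmaI finite_subset)
  qed
  then show "\<exists>b. \<phi> = indicator b \<and> (\<exists>T. finite T \<and> T \<subseteq> H \<and> determined_by T b)"
    using decided[of b] \<phi> by blast
next
  assume "\<exists>b. \<phi> = indicator b \<and> (\<exists>T. finite T \<and> T \<subseteq> H \<and> determined_by T b)"
  then obtain b T where \<phi>: "\<phi> = indicator b" and T: "finite T" "T \<subseteq> H" "determined_by T b"
    by (elim exE conjE) (rule that)
  obtain F where F: "finite F" "\<forall>n\<in>-F. \<forall>m\<in>-F. same_labels T n m \<longrightarrow> (n \<in> b \<longleftrightarrow> m \<in> b)"
    using T(3) unfolding determined_by_def by (elim exE conjE) (rule that)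
  have "\<exists>B. coarse_bounded UNIV \<E> B \<and> (\<forall>x\<in>UNIV - B. diameter (\<phi> ` (E `` {x})) < \<epsilon>)"
    if "\<epsilon> > 0" and E: "E \<in> \<E>" for \<epsilon> E
  proof -
    obtain E' where E': "E' \<in> R" "E \<subseteq> E'"
      using coarse_below[OF E] by blast
    have sym: "sym E'" and refl: "refl E'"
      using bounded_cells_equiv[OF schemeD(3)[OF scheme E'(1)]] by (simp_all add: equiv_def)
    define B where "B = E' `` F \<union> split_points T E'"
    have "finite B"
      unfolding B_def
      using bounded_cells_finite_Image[OF schemeD(3)[OF scheme E'(1)] F(1)]
        finite_split_points[OF T(1,2) schemeD(4)[OF scheme E'(1)]] by simp
    moreover have "diameter (\<phi> ` (E `` {x})) < \<epsilon>" if x: "x \<notin> B" for x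
    proof -
      have "\<phi> y = \<phi> x" if y: "(x, y) \<in> E" for y
      proof -
        have xy: "(x, y) \<in> E'" "(y, x) \<in> E'"
          using y E'(2) sym by (auto dest: symD)
        have "x \<notin> F"
          using x refl unfolding B_def by (auto simp: refl_on_def)
        moreover have "y \<notin> F"
          using x xy(2) unfolding B_def by blast
        moreover have "same_labels T x y"
          using same_labels_outside_split_points[OF sym xy(1)] x unfolding B_def by blast
        ultimately have "x \<in> b \<longleftrightarrow> y \<in> b"
          using F(2) by simp
        then show ?thesis
          by (simp add: \<phi> indicator_def)
      qed
      then have "\<phi> ` (E `` {x}) \<subseteq> {\<phi> x}"
        by auto
      then have "diameter (\<phi> ` (E `` {x})) \<le> diameter {\<phi> x}"
        by (rule diameter_subset) simp
      then show ?thesis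
        using \<open>\<epsilon> > 0\<close> by simp
    qed
    ultimately show ?thesis
      using bounded_iff_finite by (intro exI[of _ B]) simp
  qed
  moreover have "\<phi> \<in> UNIV \<rightarrow>\<^sub>E {0, 1}"
    by (auto simp: \<phi> indicator_def)
  ultimately show "\<phi> \<in> SO"
    unfolding slowly_oscillating2_def by simp
qed

lemma indicator_finite_in_SO: "finite b \<Longrightarrow> indicator b \<in> SO"
  unfolding SO_iff determined_by_def by (intro exI[of _ b] conjI refl exI[of _ "{}"]) auto

lemma indicator_label_in_SO: "(t, a) \<in> H \<Longrightarrow> indicator a \<in> SO"
  unfolding SO_iff determined_by_def same_labels_def
  by (intro exI[of _ a] conjI refl exI[of _ "{(t, a)}"] exI[of _ "{}"]) auto

lemma SO_values: "\<phi> \<in> SO \<Longrightarrow> \<phi> n \<in> {0, 1}"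
  unfolding SO_iff by (auto simp: indicator_def)


section \<open>The binary corona of a saturated scheme\<close>

abbreviation embed :: "nat \<Rightarrow> (nat \<Rightarrow> real) \<Rightarrow> real" where
  "embed \<equiv> binary_embedding UNIV \<E>"

lemma topspace_cube: "topspace (binary_cube UNIV \<E>) = SO \<rightarrow>\<^sub>E {0, 1}"
  unfolding binary_cube_def by simp

text \<open>The values lie in a discrete space, so prescribing finitely many coordinates
  gives a base of neighbourhoods.\<close>

lemma cube_closure_iff:
  "\<psi> \<in> binary_cube UNIV \<E> closure_of (embed ` A) \<longleftrightarrow>
     \<psi> \<in> SO \<rightarrow>\<^sub>E {0, 1} \<and> (\<forall>J. finite J \<and> J \<subseteq> SO \<longrightarrow> (\<exists>n\<in>A. \<forall>\<phi>\<in>J. \<phi> n = \<psi> \<phi>))"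
proof (intro iffI conjI allI impI; (elim conjE)?)
  assume cl: "\<psi> \<in> binary_cube UNIV \<E> closure_of (embed ` A)"
  show \<psi>: "\<psi> \<in> SO \<rightarrow>\<^sub>E {0, 1}"
    using subsetD[OF closure_of_subset_topspace cl] unfolding topspace_cube .
  fix J assume J: "finite J" "J \<subseteq> SO"
  define U where "U = (\<Pi>\<^sub>E \<phi>\<in>SO. if \<phi> \<in> J then {\<psi> \<phi>} else {0, 1})"
  have "openin (top_of_set {0, 1::real}) S" if "S \<subseteq> {0, 1}" for S
    using that unfolding openin_closedin_eq by (auto intro!: closed_subset finite_imp_closed)
  then have "openin (top_of_set {0, 1::real}) (if \<phi> \<in> J then {\<psi> \<phi>} else {0, 1})" if "\<phi> \<in> SO" for \<phi>
    using PiE_mem[OF \<psi> that] by simp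
  then have "openin (binary_cube UNIV \<E>) U"
    unfolding binary_cube_def U_def using J(1)
    by (intro openin_PiE_gen[THEN iffD2] disjI2 conjI ballI) (auto elim: rev_finite_subset)
  moreover have "\<psi> \<in> U"
    using \<psi> unfolding U_def by (auto simp: PiE_iff)
  ultimately obtain n where n: "n \<in> A" "embed n \<in> U"
    using cl unfolding in_closure_of by blast
  have "\<phi> n = \<psi> \<phi>" if "\<phi> \<in> J" for \<phi>
  proof -
    have "\<phi> \<in> SO"
      using that J(2) by auto
    then show ?thesis
      using PiE_mem[OF n(2)[unfolded U_def] \<open>\<phi> \<in> SO\<close>] that unfolding binary_embedding_def by simp
  qed
  then show "\<exists>n\<in>A. \<forall>\<phi>\<in>J. \<phi> n = \<psi> \<phi>"
    using n(1) by blast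
next
  assume \<psi>: "\<psi> \<in> SO \<rightarrow>\<^sub>E {0, 1}"
    and fin: "\<forall>J. finite J \<and> J \<subseteq> SO \<longrightarrow> (\<exists>n\<in>A. \<forall>\<phi>\<in>J. \<phi> n = \<psi> \<phi>)"
  show "\<psi> \<in> binary_cube UNIV \<E> closure_of (embed ` A)"
    unfolding in_closure_of topspace_cube
  proof (intro conjI allI impI; (elim conjE)?)
    show "\<psi> \<in> SO \<rightarrow>\<^sub>E {0, 1}"
      by (rule \<psi>)
    fix U assume U: "\<psi> \<in> U" "openin (binary_cube UNIV \<E>) U"
    then obtain Y where Y: "finite {\<phi> \<in> SO. Y \<phi> \<noteq> {0, 1}}" "\<psi> \<in> PiE SO Y" "PiE SO Y \<subseteq> U"
      unfolding binary_cube_def openin_product_topology_alt by auto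
    have "\<exists>n\<in>A. \<forall>\<phi>\<in>{\<phi> \<in> SO. Y \<phi> \<noteq> {0, 1}}. \<phi> n = \<psi> \<phi>"
      using Y(1) by (intro fin[rule_format] conjI) simp_all
    then obtain n where n: "n \<in> A" "\<forall>\<phi>\<in>{\<phi> \<in> SO. Y \<phi> \<noteq> {0, 1}}. \<phi> n = \<psi> \<phi>"
      by (elim bexE) (rule that)
    have "embed n \<phi> \<in> Y \<phi>" if "\<phi> \<in> SO" for \<phi>
      using n(2) SO_values[OF that, of n] PiE_mem[OF Y(2) that] that unfolding binary_embedding_def
      by (cases "Y \<phi> = {0, 1}") auto
    then have "embed n \<in> PiE SO Y"
      unfolding binary_embedding_def by auto
    then show "\<exists>y. y \<in> embed ` A \<and> y \<in> U"
      using n(1) Y(3) by blast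
  qed
qed

definition corona_points :: "((nat \<Rightarrow> real) \<Rightarrow> real) set" where
  "corona_points = {\<psi> \<in> SO \<rightarrow>\<^sub>E {0, 1}.
     \<forall>J. finite J \<and> J \<subseteq> SO \<longrightarrow> infinite {n. \<forall>\<phi>\<in>J. \<phi> n = \<psi> \<phi>}}"

text \<open>The indicators of singletons are slowly oscillating, so a neighbourhood of a point of the
  closure can avoid any finite set of naturals unless the point lies in the closure of that set.
  Hence leaving out the closures of bounded sets turns "some \<open>n\<close>" into "infinitely many \<open>n\<close>".\<close>

lemma binary_corona_eq: "binary_corona UNIV \<E> = subtopology (binary_cube UNIV \<E>) corona_points"
proof -
  let ?C = "binary_cube UNIV \<E>"
  let ?cl = "\<lambda>A. ?C closure_of (embed ` A)"
  have top: "topspace (binary_compactification UNIV \<E>) = ?cl UNIV"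
    unfolding binary_compactification_def
    by (simp add: closure_of_subset_topspace Int_absorb1)
  have "embed n \<in> topspace ?C" for n
    unfolding topspace_cube binary_embedding_def restrict_PiE_iff using SO_values by (intro ballI)
  then have "embed ` UNIV \<subseteq> topspace ?C"
    by (rule image_subsetI)
  then have "embed ` B \<subseteq> ?cl UNIV" for B
    using closure_of_subset[of "embed ` UNIV" ?C] by blast
  then have cl: "binary_compactification UNIV \<E> closure_of (embed ` B) = ?cl B" for B
    unfolding binary_compactification_def closure_of_subtopology
    by (simp add: Int_absorb1 closure_of_mono image_mono)
  have points: "?cl UNIV - \<Union>{?cl B |B. finite B} = corona_points"
  proof (intro equalityI subsetI)
    fix \<psi> assume \<psi>: "\<psi> \<in> ?cl UNIV - \<Union>{?cl B |B. finite B}"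
    have in_cl: "\<psi> \<in> ?cl UNIV" and not_cl: "\<And>B. finite B \<Longrightarrow> \<psi> \<notin> ?cl B"
      using \<psi> by auto
    have inf: "infinite {n. \<forall>\<phi>\<in>J. \<phi> n = \<psi> \<phi>}" if J: "finite J" "J \<subseteq> SO" for J
    proof
      let ?B = "{n. \<forall>\<phi>\<in>J. \<phi> n = \<psi> \<phi>}"
      assume "finite ?B"
      have "\<exists>n\<in>?B. \<forall>\<phi>\<in>J'. \<phi> n = \<psi> \<phi>" if "finite J'" "J' \<subseteq> SO" for J'
      proof -
        have "finite (J \<union> J') \<and> J \<union> J' \<subseteq> SO"
          using J that by simp
        then obtain n where "\<forall>\<phi>\<in>J \<union> J'. \<phi> n = \<psi> \<phi>"
          using in_cl unfolding cube_closure_iff by blast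
        then show ?thesis
          by blast
      qed
      then have "\<psi> \<in> ?cl ?B"
        using in_cl unfolding cube_closure_iff by simp
      then show False
        using not_cl[OF \<open>finite ?B\<close>] by simp
    qed
    then show "\<psi> \<in> corona_points"
      using in_cl unfolding corona_points_def cube_closure_iff by simp
  next
    fix \<psi> assume "\<psi> \<in> corona_points"
    then have \<psi>: "\<psi> \<in> SO \<rightarrow>\<^sub>E {0, 1}"
      and inf: "\<And>J. finite J \<Longrightarrow> J \<subseteq> SO \<Longrightarrow> infinite {n. \<forall>\<phi>\<in>J. \<phi> n = \<psi> \<phi>}"
      unfolding corona_points_def by simp_all
    have "\<psi> \<in> ?cl UNIV"
      unfolding cube_closure_iff
    proof (intro conjI allI impI; (elim conjE)?)
      fix J assume "finite J" "J \<subseteq> SO"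
      then have "{n. \<forall>\<phi>\<in>J. \<phi> n = \<psi> \<phi>} \<noteq> {}"
        using infinite_imp_nonempty[OF inf] by blast
      then show "\<exists>n\<in>UNIV. \<forall>\<phi>\<in>J. \<phi> n = \<psi> \<phi>"
        by blast
    qed (rule \<psi>)
    moreover have "\<psi> \<notin> ?cl B" if B: "finite B" for B
    proof
      assume "\<psi> \<in> ?cl B"
      define J where "J = (\<lambda>n. indicator {n} :: nat \<Rightarrow> real) ` B"
      have J: "finite J" "J \<subseteq> SO"
        using B indicator_finite_in_SO unfolding J_def by auto
      obtain m where m: "m \<in> B" "\<forall>\<phi>\<in>J. \<phi> m = \<psi> \<phi>"
        using \<open>\<psi> \<in> ?cl B\<close> J unfolding cube_closure_iff by meson
      have "infinite ({n. \<forall>\<phi>\<in>J. \<phi> n = \<psi> \<phi>} - B)"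
        using inf[OF J] B by simp
      then have "{n. \<forall>\<phi>\<in>J. \<phi> n = \<psi> \<phi>} - B \<noteq> {}"
        by (rule infinite_imp_nonempty)
      then obtain n where n: "n \<notin> B" "\<forall>\<phi>\<in>J. \<phi> n = \<psi> \<phi>"
        by blast
      have "(indicator {m} :: nat \<Rightarrow> real) \<in> J"
        using m(1) unfolding J_def by simp
      then have "(indicator {m} m :: real) = indicator {m} n"
        using m(2) n(2) by metis
      then show False
        using m(1) n(1) by (auto simp: indicator_def split: if_splits)
    qed
    ultimately show "\<psi> \<in> ?cl UNIV - \<Union>{?cl B |B. finite B}"
      by auto
  qed
  have "corona_points \<subseteq> ?cl UNIV"
    using points by blast
  then show ?thesis
    unfolding binary_corona_def top cl bounded_iff_finite points
    unfolding binary_compactification_def subtopology_subtopology by (simp add: Int_absorb1)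
qed

end


context saturated_scheme
begin

text \<open>The limit of \<open>\<phi>\<close> along the filter generated by the sets \<open>{n. fits T n z}\<close>, for finite \<open>T \<subseteq> H\<close>,
  and the cofinite sets.\<close>

definition limit :: "'a \<Rightarrow> (nat \<Rightarrow> real) \<Rightarrow> real" where
  "limit z \<phi> = (SOME v. \<exists>T. finite T \<and> T \<subseteq> H \<and> finite {n. fits T n z \<and> \<phi> n \<noteq> v})"

lemma infinite_fits: "infinite {n. fits T n z}" if "finite T" "T \<subseteq> H" "z \<in> topspace K"
  using approximation_infinite[OF schemeD(1)[OF scheme] that] .

lemma exists_fitting:
  assumes "finite T" "T \<subseteq> H" "z \<in> topspace K" "finite F"
  obtains n where "n \<notin> F" "fits T n z"
proof -
  have "infinite ({n. fits T n z} - F)"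
    using infinite_fits[OF assms(1-3)] assms(4) by simp
  then have "{n. fits T n z} - F \<noteq> {}"
    by (rule infinite_imp_nonempty)
  then show thesis
    using that by auto
qed

lemma limit_eq:
  assumes z: "z \<in> topspace K" and T: "finite T" "T \<subseteq> H" "finite {n. fits T n z \<and> \<phi> n \<noteq> v}"
  shows "limit z \<phi> = v"
proof -
  have "\<exists>S. finite S \<and> S \<subseteq> H \<and> finite {n. fits S n z \<and> \<phi> n \<noteq> limit z \<phi>}"
    unfolding limit_def by (rule someI[of _ v]) (use T in auto)
  then obtain S where S: "finite S" "S \<subseteq> H" "finite {n. fits S n z \<and> \<phi> n \<noteq> limit z \<phi>}"
    by (elim exE conjE) (rule that)
  have ST: "finite (S \<union> T)" "S \<union> T \<subseteq> H"
    using S T by auto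
  have fin: "finite ({n. fits S n z \<and> \<phi> n \<noteq> limit z \<phi>} \<union> {n. fits T n z \<and> \<phi> n \<noteq> v})"
    using S(3) T(3) by simp
  obtain n where "n \<notin> {n. fits S n z \<and> \<phi> n \<noteq> limit z \<phi>} \<union> {n. fits T n z \<and> \<phi> n \<noteq> v}"
    "fits (S \<union> T) n z"
    by (rule exists_fitting[OF ST z fin], rule that)
  then show ?thesis
    unfolding fits_Un by simp
qed

text \<open>The finite set \<open>T\<close> of labels that determines \<open>\<phi>\<close> serves for all points \<open>z\<close> at once; this
  uniformity makes the limit locally constant in \<open>z\<close>.\<close>

lemma limit_uniform:
  assumes "\<phi> \<in> SO"
  obtains T F where "finite T" "T \<subseteq> H" "finite F"
    "\<And>z n. z \<in> topspace K \<Longrightarrow> n \<notin> F \<Longrightarrow> fits T n z \<Longrightarrow> \<phi> n = limit z \<phi>"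
proof -
  obtain b T where \<phi>: "\<phi> = indicator b" and T: "finite T" "T \<subseteq> H" "determined_by T b"
    using assms unfolding SO_iff by (elim exE conjE) (rule that)
  obtain F where F: "finite F" "\<forall>n\<in>-F. \<forall>m\<in>-F. same_labels T n m \<longrightarrow> (n \<in> b \<longleftrightarrow> m \<in> b)"
    using T(3) unfolding determined_by_def by (elim exE conjE) (rule that)
  have "\<phi> n = limit z \<phi>" if z: "z \<in> topspace K" and n: "n \<notin> F" "fits T n z" for z n
  proof -
    have "\<phi> m = \<phi> n" if m: "m \<notin> F" "fits T m z" for m
      using F(2) n(1) m(1) fits_same_labels[OF m(2) n(2)] by (simp add: \<phi> indicator_def)
    then have "{m. fits T m z \<and> \<phi> m \<noteq> \<phi> n} \<subseteq> F"
      by auto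
    then have "finite {m. fits T m z \<and> \<phi> m \<noteq> \<phi> n}"
      using F(1) by (rule finite_subset)
    then show ?thesis
      using limit_eq[OF z T(1,2)] by simp
  qed
  with T(1,2) F(1) show thesis
    by (rule that)
qed

lemma limit_uniform_finite:
  assumes "finite J" "J \<subseteq> SO"
  shows "\<exists>T F. finite T \<and> T \<subseteq> H \<and> finite F \<and>
    (\<forall>z\<in>topspace K. \<forall>n. n \<notin> F \<longrightarrow> fits T n z \<longrightarrow> (\<forall>\<phi>\<in>J. \<phi> n = limit z \<phi>))"
  using assms
proof (induction J rule: finite_induct)
  case empty
  show ?case
    by (intro exI[of _ "{}"]) simp
next
  case (insert \<phi> J)
  then have "J \<subseteq> SO" "\<phi> \<in> SO"
    by auto
  obtain T F where T: "finite T" "T \<subseteq> H" "finite F"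
    "\<forall>z\<in>topspace K. \<forall>n. n \<notin> F \<longrightarrow> fits T n z \<longrightarrow> (\<forall>\<phi>\<in>J. \<phi> n = limit z \<phi>)"
    using insert.IH[OF \<open>J \<subseteq> SO\<close>] by (elim exE conjE) (rule that)
  obtain T' F' where T': "finite T'" "T' \<subseteq> H" "finite F'"
    "\<And>z n. z \<in> topspace K \<Longrightarrow> n \<notin> F' \<Longrightarrow> fits T' n z \<Longrightarrow> \<phi> n = limit z \<phi>"
    by (rule limit_uniform[OF \<open>\<phi> \<in> SO\<close>], rule that)
  show ?case
    using T T' by (intro exI[of _ "T \<union> T'"] exI[of _ "F \<union> F'"]) (auto simp: fits_Un)
qed

definition corona_point :: "'a \<Rightarrow> (nat \<Rightarrow> real) \<Rightarrow> real" where
  "corona_point z = (\<lambda>\<phi>\<in>SO. limit z \<phi>)"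

lemma limit_values:
  assumes "\<phi> \<in> SO" "z \<in> topspace K"
  shows "limit z \<phi> \<in> {0, 1}"
proof -
  obtain T F where T: "finite T" "T \<subseteq> H" "finite F"
    "\<And>z n. z \<in> topspace K \<Longrightarrow> n \<notin> F \<Longrightarrow> fits T n z \<Longrightarrow> \<phi> n = limit z \<phi>"
    by (rule limit_uniform[OF assms(1)], rule that)
  obtain n where "n \<notin> F" "fits T n z"
    by (rule exists_fitting[OF T(1,2) assms(2) T(3)], rule that)
  then show ?thesis
    using T(4)[OF assms(2)] SO_values[OF assms(1)] by metis
qed

lemma corona_point_in_corona:
  assumes z: "z \<in> topspace K"
  shows "corona_point z \<in> corona_points"
  unfolding corona_points_def
proof (intro CollectI conjI allI impI; (elim conjE)?)
  show "corona_point z \<in> SO \<rightarrow>\<^sub>E {0, 1}"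
    unfolding corona_point_def restrict_PiE_iff using limit_values[OF _ z] by (intro ballI)
  fix J assume J: "finite J" "J \<subseteq> SO"
  obtain T F where T: "finite T" "T \<subseteq> H" "finite F"
    "\<forall>z\<in>topspace K. \<forall>n. n \<notin> F \<longrightarrow> fits T n z \<longrightarrow> (\<forall>\<phi>\<in>J. \<phi> n = limit z \<phi>)"
    using limit_uniform_finite[OF J] by (elim exE conjE) (rule that)
  have "infinite ({n. fits T n z} - F)"
    using infinite_fits[OF T(1,2) z] T(3) by simp
  moreover have "{n. fits T n z} - F \<subseteq> {n. \<forall>\<phi>\<in>J. \<phi> n = corona_point z \<phi>}"
    using T(4) z J(2) unfolding corona_point_def by auto
  ultimately show "infinite {n. \<forall>\<phi>\<in>J. \<phi> n = corona_point z \<phi>}"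
    by (rule infinite_super[rotated])
qed

lemma limit_label:
  assumes "(t, a) \<in> H" "z \<in> topspace K"
  shows "limit z (indicator a) = indicator t z"
  using assms by (intro limit_eq[of _ "{(t, a)}"]) (auto simp: fits_def indicator_def)

text \<open>The values of \<open>\<psi>\<close> at the labels prescribe, for each labelled clopen set, whether the required
  point belongs to it. Finitely many prescriptions are realised by infinitely many naturals, almost
  all of which fit a point of \<open>K\<close>; so compactness gives a point that meets all of them.\<close>

lemma exists_point_of_corona_point:
  assumes \<psi>: "\<psi> \<in> corona_points"
  shows "\<exists>z\<in>topspace K. corona_point z = \<psi>"
proof -
  have PiE: "\<psi> \<in> SO \<rightarrow>\<^sub>E {0, 1}"
    and inf: "\<And>J. finite J \<Longrightarrow> J \<subseteq> SO \<Longrightarrow> infinite {n. \<forall>\<phi>\<in>J. \<phi> n = \<psi> \<phi>}"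
    using \<psi> unfolding corona_points_def by simp_all
  define C where "C = (\<lambda>(t, a). if \<psi> (indicator a) = 1 then t else topspace K - t)"
  have labels: "(indicator ` snd ` T :: (nat \<Rightarrow> real) set) \<subseteq> SO" if "T \<subseteq> H" for T
    using indicator_label_in_SO that by force
  have agree: "infinite {n. \<forall>\<phi>\<in>J \<union> indicator ` snd ` T. \<phi> n = \<psi> \<phi>}"
    if "finite T" "T \<subseteq> H" "finite J" "J \<subseteq> SO" for T J
    using that labels by (intro inf) auto
  have C_iff: "z \<in> C p \<longleftrightarrow> (n \<in> snd p \<longleftrightarrow> z \<in> fst p)"
    if "p \<in> T" "\<forall>\<phi>\<in>J \<union> indicator ` snd ` T. \<phi> n = \<psi> \<phi>" "z \<in> topspace K" for p T J n z
  proof -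
    have "(indicator (snd p) n :: real) = \<psi> (indicator (snd p))"
      using that(1,2) by blast
    then show ?thesis
      using that(3) unfolding C_def by (cases p) (auto simp: indicator_def split: if_splits)
  qed
  have "\<Inter>(C ` H) \<noteq> {}"
  proof (rule compact_space_fip[THEN iffD1, rule_format, OF compact], intro conjI ballI allI impI; (elim conjE)?)
    fix D assume "D \<in> C ` H"
    then show "closedin K D"
      using schemeD(2)[OF scheme] unfolding C_def by force
  next
    fix \<F> assume "finite \<F>" "\<F> \<subseteq> C ` H"
    then obtain T where T: "T \<subseteq> H" "finite T" "\<F> = C ` T"
      by (meson finite_subset_image)
    have "infinite ({n. \<forall>\<phi>\<in>{} \<union> indicator ` snd ` T. \<phi> n = \<psi> \<phi>}
        - {n. \<nexists>z. z \<in> topspace K \<and> fits T n z})"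
      using agree[OF T(2,1), of "{}"] schemeD(1)[OF scheme] T unfolding approximation_def
      by (intro Diff_infinite_finite) auto
    from infinite_imp_nonempty[OF this]
    obtain n z where n: "\<forall>\<phi>\<in>{} \<union> indicator ` snd ` T. \<phi> n = \<psi> \<phi>" and z: "z \<in> topspace K" "fits T n z"
      by blast
    have "z \<in> C p" if "p \<in> T" for p
      using C_iff[OF that n z(1)] z(2) that unfolding fits_def by (cases p) auto
    then show "\<Inter>\<F> \<noteq> {}"
      unfolding T(3) by blast
  qed
  then obtain z where z: "\<And>p. p \<in> H \<Longrightarrow> z \<in> C p"
    by blast
  obtain a where "(topspace K, a) \<in> H"
    using labelled[of "topspace K"] by auto
  then have z_top: "z \<in> topspace K"
    using z[of "(topspace K, a)"] unfolding C_def by (auto split: if_splits)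
  have "limit z \<phi> = \<psi> \<phi>" if \<phi>: "\<phi> \<in> SO" for \<phi>
  proof -
    obtain T F where T: "finite T" "T \<subseteq> H" "finite F"
      "\<And>z n. z \<in> topspace K \<Longrightarrow> n \<notin> F \<Longrightarrow> fits T n z \<Longrightarrow> \<phi> n = limit z \<phi>"
      by (rule limit_uniform[OF \<phi>], rule that)
    have "infinite ({n. \<forall>\<phi>'\<in>{\<phi>} \<union> indicator ` snd ` T. \<phi>' n = \<psi> \<phi>'} - F)"
      using agree[OF T(1,2), of "{\<phi>}"] \<phi> T(3) by (intro Diff_infinite_finite) auto
    from infinite_imp_nonempty[OF this]
    obtain n where n: "\<forall>\<phi>'\<in>{\<phi>} \<union> indicator ` snd ` T. \<phi>' n = \<psi> \<phi>'" "n \<notin> F"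
      by blast
    have "fits T n z"
      unfolding fits_def
    proof (intro allI impI)
      fix t a assume ta: "(t, a) \<in> T"
      then have "z \<in> C (t, a)"
        using z T(2) by blast
      then show "n \<in> a \<longleftrightarrow> z \<in> t"
        using C_iff[OF ta n(1) z_top] by simp
    qed
    then show ?thesis
      using T(4)[OF z_top n(2)] n(1) by simp
  qed
  then have "corona_point z = \<psi>"
    using PiE unfolding corona_point_def by (intro ext) (auto simp: PiE_iff extensional_def)
  then show ?thesis
    using z_top by blast
qed

lemma corona_point_inj: "inj_on corona_point (topspace K)"
proof (rule inj_onI, rule ccontr)
  fix z z' assume z: "z \<in> topspace K" "z' \<in> topspace K" "corona_point z = corona_point z'" "z \<noteq> z'"
  then obtain V where V: "openin K V" "z \<in> V" "z' \<notin> V"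
    using Hausdorff_imp_t1_space[OF Hausdorff] unfolding t1_space_def by metis
  obtain U where U: "openin K U" "closedin K U" "z \<in> U" "U \<subseteq> V"
    using dim V(1,2) unfolding dim_le_0_iff_clopen_base topology_base_def by metis
  obtain a where a: "(U, a) \<in> H"
    using labelled[OF U(1,2)] by blast
  have "limit z (indicator a) = limit z' (indicator a)"
    using fun_cong[OF z(3), of "indicator a"] indicator_label_in_SO[OF a] unfolding corona_point_def by simp
  then show False
    using limit_label[OF a] z(1,2) U V by (auto simp: indicator_def split: if_splits)
qed

lemma openin_same_traces:
  assumes "finite T" "T \<subseteq> H"
  shows "openin K {z' \<in> topspace K. \<forall>p\<in>T. z' \<in> fst p \<longleftrightarrow> z \<in> fst p}"
  using assms
proof (induction T rule: finite_induct)
  case empty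
  show ?case
    by simp
next
  case (insert p T)
  have "openin K (fst p)" "closedin K (fst p)"
    using insert.prems schemeD(2)[OF scheme] by auto
  then have "openin K (if z \<in> fst p then fst p else topspace K - fst p)"
    by auto
  moreover have "{z' \<in> topspace K. \<forall>q\<in>insert p T. z' \<in> fst q \<longleftrightarrow> z \<in> fst q} =
      {z' \<in> topspace K. \<forall>q\<in>T. z' \<in> fst q \<longleftrightarrow> z \<in> fst q} \<inter>
      (if z \<in> fst p then fst p else topspace K - fst p)"
    by auto
  ultimately show ?case
    using insert by (simp add: openin_Int)
qed

lemma limit_locally_constant:
  assumes \<phi>: "\<phi> \<in> SO"
  shows "continuous_map K (top_of_set {0, 1}) (\<lambda>z. limit z \<phi>)"
  unfolding continuous_map_def
proof (intro conjI allI impI)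
  show "(\<lambda>z. limit z \<phi>) \<in> topspace K \<rightarrow> topspace (top_of_set {0, 1})"
    using limit_values[OF \<phi>] by simp
  fix V :: "real set"
  obtain T F where T: "finite T" "T \<subseteq> H" "finite F"
    "\<And>z n. z \<in> topspace K \<Longrightarrow> n \<notin> F \<Longrightarrow> fits T n z \<Longrightarrow> \<phi> n = limit z \<phi>"
    by (rule limit_uniform[OF \<phi>], rule that)
  show "openin K {z \<in> topspace K. limit z \<phi> \<in> V}"
  proof (subst openin_subopen, intro ballI)
    fix z assume "z \<in> {z \<in> topspace K. limit z \<phi> \<in> V}"
    then have z: "z \<in> topspace K" "limit z \<phi> \<in> V"
      by auto
    obtain n where n: "n \<notin> F" "fits T n z"
      by (rule exists_fitting[OF T(1,2) z(1) T(3)], rule that)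
    let ?N = "{z' \<in> topspace K. \<forall>p\<in>T. z' \<in> fst p \<longleftrightarrow> z \<in> fst p}"
    have "limit z' \<phi> \<in> V \<and> z' \<in> topspace K" if z': "z' \<in> ?N" for z'
    proof -
      have "fits T n z'"
        using n(2) z' unfolding fits_def by fastforce
      then show ?thesis
        using T(4)[OF _ n(1)] n(2) z z' by (metis (mono_tags, lifting) mem_Collect_eq)
    qed
    then have "?N \<subseteq> {z \<in> topspace K. limit z \<phi> \<in> V}"
      by (intro subsetI CollectI) simp
    moreover have "z \<in> ?N"
      using z(1) by simp
    ultimately show "\<exists>N. openin K N \<and> z \<in> N \<and> N \<subseteq> {z \<in> topspace K. limit z \<phi> \<in> V}"
      using openin_same_traces[OF T(1,2), of z] by (intro exI[of _ ?N] conjI)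
  qed
qed

lemma homeomorphic_binary_corona: "K homeomorphic_space binary_corona UNIV \<E>"
proof -
  let ?Y = "subtopology (binary_cube UNIV \<E>) corona_points"
  have top: "topspace ?Y = corona_points"
    using topspace_cube unfolding corona_points_def by auto
  have image: "corona_point ` topspace K = corona_points"
    using corona_point_in_corona exists_point_of_corona_point by auto
  have "continuous_map K (binary_cube UNIV \<E>) corona_point"
    unfolding binary_cube_def continuous_map_componentwise
  proof (intro conjI ballI)
    show "corona_point ` topspace K \<subseteq> extensional SO"
      unfolding corona_point_def by auto
    show "continuous_map K (top_of_set {0, 1}) (\<lambda>z. corona_point z \<phi>)" if "\<phi> \<in> SO" for \<phi>
      using limit_locally_constant[OF that] that unfolding corona_point_def by simp
  qed
  then have "continuous_map K ?Y corona_point"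
    using image by (auto simp: continuous_map_in_subtopology)
  moreover have "Hausdorff_space ?Y"
    unfolding binary_cube_def
    by (intro Hausdorff_space_subtopology) (simp add: Hausdorff_space_product_topology Hausdorff_space_subtopology)
  ultimately have "homeomorphic_map K ?Y corona_point"
    using compact top image corona_point_inj by (intro continuous_imp_homeomorphic_map) simp_all
  then show ?thesis
    unfolding binary_corona_eq by (rule homeomorphic_map_imp_homeomorphic_space)
qed

end


section \<open>Cardinalities under the continuum hypothesis\<close>

text \<open>Under the continuum hypothesis the cardinality of the power set of the naturals is the least
  uncountable cardinal, so that the initial segments of a corresponding well-order are countable.\<close>

lemma nat_sets_well_order:
  assumes "continuum_hypothesis"
  obtains r :: "nat set rel" where "wf r" "trans r" "total r" "\<And>b. countable {b'. (b', b) \<in> r}"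
proof -
  let ?c = "|UNIV :: nat set set|"
  have wo: "well_order_on UNIV ?c"
    by (rule card_of_well_order_on)
  have "?c =o |UNIV :: real set|"
    using nat_sets_eqpoll_reals by (simp add: eqpoll_iff_card_of_ordIso)
  then have c: "?c =o omega1"
    using assms unfolding continuum_hypothesis_def by (rule ordIso_transitive)
  let ?r = "?c - Id"
  have "wf ?r" "trans ?r" "total ?r"
    using wo trans_diff_Id[of ?c]
    unfolding well_order_on_def linear_order_on_def partial_order_on_def preorder_on_def
    by (auto simp: total_on_diff_Id)
  moreover have "countable {b'. (b', b) \<in> ?r}" for b
  proof -
    have "|underS ?c b| <o ?c"
      by (rule card_of_underS[OF card_of_Card_order]) (simp add: Field_card_of)
    then have "|underS ?c b| <o omega1"
      using c by (rule ordLess_ordIso_trans)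
    then have "|underS ?c b| \<le>o natLeq"
      using cardSuc_ordLeq_ordLess[of natLeq "|underS ?c b|"] natLeq_Card_order card_of_Card_order by blast
    then have "|underS ?c b| \<le>o |UNIV :: nat set|"
      using ordIso_symmetric[OF card_of_nat] by (rule ordLeq_ordIso_trans)
    then have "countable (underS ?c b)"
      unfolding countable_def using card_of_ordLeq[of "underS ?c b" "UNIV :: nat set"] by auto
    moreover have "{b'. (b', b) \<in> ?r} = underS ?c b"
      unfolding underS_def by auto
    ultimately show ?thesis
      by simp
  qed
  ultimately show thesis
    by (rule that)
qed

text \<open>By compactness a clopen set is a finite union of members of a base. The base injects into the
  power set of the naturals, and a set \<open>S\<close> of naturals, read as a sequence of rows, codes
  a sequence of members of the base. Entry \<open>0\<close> of a row tells whether the row is in use, which makes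
  the empty union available as well.\<close>

lemma clopen_sets_range:
  assumes "continuum_hypothesis" "compact_space K" "weight_le K omega1"
  obtains g :: "nat set \<Rightarrow> 'a set" where "range g = {U. openin K U \<and> closedin K U}"
proof -
  obtain \<B> where \<B>: "topology_base K \<B>" "|\<B>| \<le>o omega1"
    using assms(3) unfolding weight_le_def by blast
  have "|UNIV :: nat set set| =o |UNIV :: real set|"
    using nat_sets_eqpoll_reals by (simp add: eqpoll_iff_card_of_ordIso)
  then have "|UNIV :: nat set set| =o omega1"
    using assms(1) unfolding continuum_hypothesis_def by (rule ordIso_transitive)
  then have "|\<B>| \<le>o |UNIV :: nat set set|"
    using \<B>(2) ordIso_symmetric ordLeq_ordIso_trans by blast
  then obtain code :: "'a set \<Rightarrow> nat set" where code: "inj_on code \<B>"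
    using card_of_ordLeq[of \<B> "UNIV :: nat set set"] by auto
  define row where "row S n = {m. prod_encode (n, Suc m) \<in> S}" for S :: "nat set" and n
  define h where "h S = \<Union>{B \<in> \<B>. \<exists>n. prod_encode (n, 0) \<in> S \<and> code B = row S n}" for S
  define g where "g S = (if closedin K (h S) then h S else {})" for S
  have open_h: "openin K (h S)" for S
    using \<B>(1) unfolding h_def topology_base_def by auto
  have "\<exists>S. h S = \<Union>\<F>" if \<F>: "finite \<F>" "\<F> \<subseteq> \<B>" for \<F>
  proof -
    obtain e :: "'a set \<Rightarrow> nat" where e: "inj_on e \<F>"
      using finite_imp_inj_to_nat_seg[OF \<F>(1)] by blast
    define S where "S = {prod_encode (e B, 0) |B. B \<in> \<F>} \<union> {prod_encode (e B, Suc m) |B m. B \<in> \<F> \<and> m \<in> code B}"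
    have head: "prod_encode (n, 0) \<in> S \<longleftrightarrow> (\<exists>B\<in>\<F>. n = e B)" for n
      unfolding S_def by auto
    have rows: "row S (e B) = code B" if "B \<in> \<F>" for B
      using that inj_onD[OF e] unfolding S_def row_def by auto
    have "{B \<in> \<B>. \<exists>n. prod_encode (n, 0) \<in> S \<and> code B = row S n} = \<F>"
    proof (intro equalityI subsetI)
      fix B assume "B \<in> {B \<in> \<B>. \<exists>n. prod_encode (n, 0) \<in> S \<and> code B = row S n}"
      then obtain B' where B: "B \<in> \<B>" "B' \<in> \<F>" "code B = code B'"
        using head rows by auto
      then have "B = B'"
        using inj_onD[OF code B(3)] \<F>(2) by auto
      then show "B \<in> \<F>"
        using B(2) by simp
    next
      fix B assume "B \<in> \<F>"
      then show "B \<in> {B \<in> \<B>. \<exists>n. prod_encode (n, 0) \<in> S \<and> code B = row S n}"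
        using \<F>(2) head rows by auto
    qed
    then show ?thesis
      unfolding h_def by auto
  qed
  note h_finite = this
  have "U \<in> range g" if U: "openin K U" "closedin K U" for U
  proof -
    have "compactin K U"
      using closedin_compact_space[OF assms(2) U(2)] .
    moreover have "\<And>B. B \<in> {B \<in> \<B>. B \<subseteq> U} \<Longrightarrow> openin K B"
      using \<B>(1) unfolding topology_base_def by auto
    moreover have "U \<subseteq> \<Union>{B \<in> \<B>. B \<subseteq> U}"
      using \<B>(1) U(1) unfolding topology_base_def by blast
    ultimately have "\<exists>\<F>. finite \<F> \<and> \<F> \<subseteq> {B \<in> \<B>. B \<subseteq> U} \<and> U \<subseteq> \<Union>\<F>"
      by (rule compactinD)
    then obtain \<F> where \<F>: "finite \<F>" "\<F> \<subseteq> {B \<in> \<B>. B \<subseteq> U}" "U \<subseteq> \<Union>\<F>"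
      by (elim exE conjE) (rule that)
    then have "\<Union>\<F> = U" "\<F> \<subseteq> \<B>"
      by auto
    then obtain S where "h S = U"
      using h_finite[OF \<F>(1)] by auto
    then have "g S = U"
      using U(2) unfolding g_def by simp
    then show ?thesis
      by blast
  qed
  moreover have "openin K (g S) \<and> closedin K (g S)" for S
    using open_h unfolding g_def by simp
  ultimately have "range g = {U. openin K U \<and> closedin K U}"
    by auto
  then show thesis
    by (rule that)
qed


section \<open>Coronas of cellular finitary coarse spaces\<close>

theorem corollary9p10:
  fixes K :: "'a topology"
  assumes "continuum_hypothesis"
    and "compact_space K" and "Hausdorff_space K" and "K dim_le 0" and "topspace K \<noteq> {}"
    and "weight_le K omega1"
  shows "\<exists>(X :: nat set) \<E>. coarse_space X \<E> \<and> finitary X \<E> \<and> cellular X \<E> \<and>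
           |X| =o natLeq \<and> K homeomorphic_space binary_corona X \<E>"
proof -
  obtain r :: "nat set rel" where r: "wf r" "trans r" "total r" "\<And>b. countable {b'. (b', b) \<in> r}"
    by (rule nat_sets_well_order[OF assms(1)], rule that)
  obtain g :: "nat set \<Rightarrow> 'a set" where g: "range g = {U. openin K U \<and> closedin K U}"
    by (rule clopen_sets_range[OF assms(1,2,6)], rule that)
  have "\<exists>H R. scheme (topspace K) (range g) H R \<and> (\<forall>n. \<exists>E\<in>R. {..n} \<times> {..n} \<subseteq> E) \<and>
      (\<forall>b. \<exists>a. (g b, a) \<in> H) \<and>
      (\<forall>b. (\<exists>T. finite T \<and> T \<subseteq> H \<and> determined_by T b) \<or> (\<exists>E\<in>R. infinite (E \<inter> b \<times> - b)))"
    using assms(5) r by (rule exists_saturated_scheme)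
  then obtain H R where HR: "scheme (topspace K) (range g) H R" "\<forall>n. \<exists>E\<in>R. {..n} \<times> {..n} \<subseteq> E"
    "\<forall>b. \<exists>a. (g b, a) \<in> H"
    "\<forall>b. (\<exists>T. finite T \<and> T \<subseteq> H \<and> determined_by T b) \<or> (\<exists>E\<in>R. infinite (E \<inter> b \<times> - b))"
    by (elim exE conjE) (rule that)
  have labelled: "\<exists>a. (U, a) \<in> H" if "openin K U" "closedin K U" for U
  proof -
    have "U \<in> range g"
      using that g by simp
    then show ?thesis
      using HR(3) by auto
  qed
  interpret saturated_scheme K H R
  proof
    show "scheme (topspace K) {U. openin K U \<and> closedin K U} H R"
      using HR(1) unfolding g .
  qed (use assms(2-4) HR(2,4) labelled in simp_all)
  show ?thesis
    using coarse finitary cellular card_of_nat homeomorphic_binary_corona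
    by (intro exI[of _ UNIV] exI[of _ "generated_coarse_structure R"] conjI)
qed

end
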